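(* Let $G$ be a countable amenable group with left Følner sequence $(F_n)_n$, let $d\ge1$, let $\mathbf{X}=(X,\mu,T_1,\ldots,T_d)$ be a $G^d$-space, let $1\leq j\leq d$, and let the tower of $G^d$-spaces $\mathbf{Y}^{(d)}\to\cdots\to\mathbf{Y}^{(1)}\to\mathbf{Y}^{(0)}=\mathbf{X}$, with $\mathbf{Y}^{(j)}=(Y^{(j)},\nu^{(j)},S^{(j)})$, and the maps $\pi^{(j)}_\eta:Y^{(j)}\to X$ for $\eta\in\{0,1\}^j$ be constructed as described in the context. For $f_{d-j+1},\ldots,f_d\in L^\infty(\mu)$ let $$\Lambda^{(j)}_n(f_{d-j+1},\ldots,f_d):=\frac{1}{|F_n|}\sum_{g\in F_n}\prod_{i=d-j+1}^d\big(f_i\circ T^g_{[d-j+1;i]}\big).$$ If $f_{d-j+1},\ldots,f_d$ are all uniformly bounded by $1$, then $$\limsup_{n\to\infty}\big\|\Lambda_n^{(j)}(f_{d-j+1},\ldots,f_d)\big\|_2\leq\Big(\int_{Y^{(j)}}\prod_{\eta\in\{0,1\}^j}\big(\mathcal{C}^{|\eta|}f_d\circ\pi^{(j)}_\eta\big)\,\mathrm{d}\nu^{(j)}\Big)^{2^{-j}},$$ where $|\eta|:=\sum_i\eta_i\bmod 2$ and $\mathcal{C}$ is the operator of complex conjugation.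
   Context: For a countable group $\Gamma$, a $\Gamma$-space is a triple $(X,\mu,T)$ with $(X,\mu)$ standard Borel probability and $T:\Gamma\curvearrowright X$ measurable and $\mu$-preserving. A factor map (equivalently, extension) $(X,\mu,T)\to(Y,\nu,S)$ is a measurable $\pi:X\to Y$ with $\pi_*\mu=\nu$ and $S^g\circ\pi=\pi\circ T^g$ a.e. for all $g$. For $H\le\Gamma$, $\mathbf{X}^{\upharpoonright H}$ denotes the $H$-space obtained by restricting the action, and $\Sigma_{\mathbf{X}}^H$ the $\sigma$-algebra of measurable $A$ with $\mu(T^hA\triangle A)=0$ for all $h\in H$. If $\Phi$ is a $\sigma$-subalgebra and $x\mapsto\mu_x$ a disintegration of $\mu$ over $\Phi$, then $\mu\otimes_\Phi\mu:=\int\mu_x\otimes\mu_x\,\mu(\mathrm{d}x)$ on $X^2$. A left Følner sequence consists of finite non-empty $F_n\subseteq G$ with $|gF_n\triangle F_n|/|F_n|\to0$ for every $g\in G$. A $G^d$-space is written $(X,\mu,T_1,\ldots,T_d)$, where $T_1,\dots,T_d$ are the commuting $G$-actions of the coordinate copies of $G$. For integers $1\le a\leq b\le d$, $T^g_{[a;b]}=T^g_{(a-1;b]}:=T^g_aT^g_{a+1}\cdots T^g_b$; this is a $G$-action. The same notation is used for other actions such as $S^{(j)}$. For $m\in\{0,1,\ldots,d-1\}$ let $H_{\{m,d\}}:=\{\mathbf{g}\in G^d\mid g_{m+1}=g_{m+2}=\cdots=g_d\}$ and $L_{\{m,d\}}:=\{\mathbf{g}\in H_{\{m,d\}}\mid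 g_i=1_G\ \forall i\leq m\}$. Construction of the tower. Put $\mathbf{Y}^{(0)}:=\mathbf{X}$. Given $\mathbf{Y}^{(j)}=(Y^{(j)},\nu^{(j)},S^{(j)})$ with $0\leq j\leq d-1$, let $m:=d-j-1$. (i) Define an $H_{\{m,d\}}$-action $\widetilde{S}^{(j)}$ on $(Y^{(j)},\nu^{(j)})$ by $(\widetilde{S}^{(j)}_i)^g:=(S^{(j)}_i)^g$ for $i<m$, $(\widetilde{S}^{(j)}_m)^g:=(S^{(j)}_{[m;d]})^g$, and $(\widetilde{S}^{(j)}_{(m;d]})^g:=\mathrm{id}$, for $g\in G$ (the first two conditions are vacuous if $m=0$). That is, $\mathbf{g}=(g_1,\ldots,g_m,h,\ldots,h)\in H_{\{m,d\}}$ acts by $(S_1^{(j)})^{g_1}\cdots(S_{m-1}^{(j)})^{g_{m-1}}(S^{(j)}_{[m;d]})^{g_m}$. (ii) Let $\mathbf{Z}^{(j+1)}=(Z^{(j+1)},\theta^{(j+1)},R^{(j+1)})$ be the $H_{\{m,d\}}$-space $$\big(Y^{(j)}\times Y^{(j)},\ \nu^{(j)}\otimes_{\Sigma^{L_{\{m,d\}}}_{\mathbf{Y}^{(j)}}}\nu^{(j)},\ (S^{(j)})^{\upharpoonright H_{\{m,d\}}}\times\widetilde{S}^{(j)}\big),$$ and let $\xi^{(j+1)}_0,\xi^{(j+1)}_1:Z^{(j+1)}\to Y^{(j)}$ be the first and second coordinate projections. (iii) Let $\xi^{(j+1)}:\mathbf{Y}^{(j+1)}\to\mathbf{Y}^{(j)}$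 be any extension of $G^d$-spaces together with a factor map of $H_{\{m,d\}}$-spaces $\alpha^{(j+1)}:(\mathbf{Y}^{(j+1)})^{\upharpoonright H_{\{m,d\}}}\to\mathbf{Z}^{(j+1)}$ such that $\xi^{(j+1)}=\xi^{(j+1)}_0\circ\alpha^{(j+1)}$ (such extensions always exist). For $j\in\{1,\ldots,d\}$ and $\eta=(\eta_1,\ldots,\eta_j)\in\{0,1\}^j$ set $$\pi^{(j)}_\eta:=\xi^{(1)}_{\eta_1}\circ\alpha^{(1)}\circ\xi^{(2)}_{\eta_2}\circ\alpha^{(2)}\circ\cdots\circ\xi^{(j)}_{\eta_j}\circ\alpha^{(j)}:Y^{(j)}\to X.$$ *)

theory Defs
  imports
    "HOL-Probability.Probability"
    "HOL-Algebra.Group_Action"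
    "HOL-Algebra.Product_Groups"
begin

section \<open>Probability-preserving actions of countable groups\<close>

definition standard_borel :: "'a measure \<Rightarrow> bool" where
  "standard_borel M \<longleftrightarrow>
     (\<exists>X. completely_metrizable_space X \<and> second_countable X \<and>
          topspace X = space M \<and> sets M = sigma_sets (topspace X) {U. openin X U})"

text \<open>The maps \<open>T g\<close> are only relevant on \<open>space M\<close>; the restriction is needed because
  \<^const>\<open>group_action\<close> deals with extensional functions. As the group is countable,
  measurability of the action amounts to measurability of each \<open>T g\<close>.\<close>

definition pmp_space ::
  "('g, 'b) monoid_scheme \<Rightarrow> 'a measure \<Rightarrow> ('g \<Rightarrow> 'a \<Rightarrow> 'a) \<Rightarrow> bool" where
  "pmp_space \<Gamma> M T \<longleftrightarrow>
     prob_space M \<and> standard_borel M \<and>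
     group_action \<Gamma> (space M) (\<lambda>g. restrict (T g) (space M)) \<and>
     (\<forall>g\<in>carrier \<Gamma>. T g \<in> M \<rightarrow>\<^sub>M M \<and> distr M M (T g) = M)"

definition factor_map ::
  "('g, 'b) monoid_scheme \<Rightarrow> 'a measure \<Rightarrow> ('g \<Rightarrow> 'a \<Rightarrow> 'a) \<Rightarrow>
     'c measure \<Rightarrow> ('g \<Rightarrow> 'c \<Rightarrow> 'c) \<Rightarrow> ('a \<Rightarrow> 'c) \<Rightarrow> bool" where
  "factor_map \<Gamma> M T N S \<pi> \<longleftrightarrow>
     \<pi> \<in> M \<rightarrow>\<^sub>M N \<and> distr M N \<pi> = N \<and>
     (\<forall>g\<in>carrier \<Gamma>. AE x in M. S g (\<pi> x) = \<pi> (T g x))"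

text \<open>The \<open>\<sigma>\<close>-algebra of almost \<open>H\<close>-invariant sets, represented by a measure of which only
  the underlying set and the measurable sets matter.\<close>

definition inv_algebra :: "'a measure \<Rightarrow> ('g \<Rightarrow> 'a \<Rightarrow> 'a) \<Rightarrow> 'g set \<Rightarrow> 'a measure" where
  "inv_algebra M T H =
     sigma (space M) {A \<in> sets M. \<forall>h\<in>H. emeasure M (sym_diff (T h ` A) A) = 0}"

definition disintegration :: "'a measure \<Rightarrow> 'a measure \<Rightarrow> ('a \<Rightarrow> 'a measure) \<Rightarrow> bool" where
  "disintegration M \<Phi> \<kappa> \<longleftrightarrow>
     \<kappa> \<in> \<Phi> \<rightarrow>\<^sub>M prob_algebra M \<and>
     (\<forall>A\<in>sets M. \<forall>C\<in>sets \<Phi>. (\<integral>\<^sup>+x\<in>C. emeasure (\<kappa> x) A \<partial>M) = emeasure M (A \<inter> C))"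

text \<open>\<open>\<integral> \<kappa>\<^sub>x \<otimes> \<kappa>\<^sub>x \<mu>(dx)\<close>, the relatively independent self-joining if \<open>\<kappa>\<close> is a disintegration
  of \<open>\<mu>\<close> over a \<open>\<sigma>\<close>-subalgebra; it does not depend on which disintegration is used.\<close>

definition rel_square :: "'a measure \<Rightarrow> ('a \<Rightarrow> 'a measure) \<Rightarrow> ('a \<times> 'a) measure" where
  "rel_square M \<kappa> = M \<bind> (\<lambda>x. \<kappa> x \<Otimes>\<^sub>M \<kappa> x)"

definition l2_norm :: "'a measure \<Rightarrow> ('a \<Rightarrow> complex) \<Rightarrow> real" where
  "l2_norm M f = sqrt (\<integral>x. (cmod (f x))\<^sup>2 \<partial>M)"

text \<open>A countable group is amenable iff it has such a sequence.\<close>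

definition left_Folner :: "('g, 'b) monoid_scheme \<Rightarrow> (nat \<Rightarrow> 'g set) \<Rightarrow> bool" where
  "left_Folner G F \<longleftrightarrow>
     (\<forall>n. finite (F n) \<and> F n \<noteq> {} \<and> F n \<subseteq> carrier G) \<and>
     (\<forall>g\<in>carrier G.
        (\<lambda>n. real (card (sym_diff (g <#\<^bsub>G\<^esub> F n) (F n))) / real (card (F n)))
          \<longlonglongrightarrow> 0)"

section \<open>Actions of powers of a group\<close>

text \<open>Elements of \<open>G\<^sup>d\<close> are functions on \<open>{1..d}\<close>, extended by \<^const>\<open>undefined\<close>.\<close>

abbreviation gpow :: "('g, 'b) monoid_scheme \<Rightarrow> nat \<Rightarrow> (nat \<Rightarrow> 'g) monoid" where
  "gpow G d \<equiv> product_group {1..d} (\<lambda>_. G)"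

text \<open>\<open>T\<^sub>i\<^sup>g\<close>: the action of the \<open>i\<close>-th coordinate copy of \<open>G\<close>.\<close>

definition coord_act ::
  "('g, 'b) monoid_scheme \<Rightarrow> nat \<Rightarrow> ((nat \<Rightarrow> 'g) \<Rightarrow> 'a \<Rightarrow> 'a) \<Rightarrow> nat \<Rightarrow> 'g \<Rightarrow> 'a \<Rightarrow> 'a" where
  "coord_act G d T i g = T (\<lambda>k\<in>{1..d}. if k = i then g else \<one>\<^bsub>G\<^esub>)"

text \<open>\<open>T\<^sub>[\<^sub>a\<^sub>;\<^sub>b\<^sub>]\<^sup>g = T\<^sub>a\<^sup>g T\<^bsub>a+1\<^esub>\<^sup>g \<cdots> T\<^sub>b\<^sup>g\<close>\<close>

definition block_act ::
  "('g, 'b) monoid_scheme \<Rightarrow> nat \<Rightarrow> ((nat \<Rightarrow> 'g) \<Rightarrow> 'a \<Rightarrow> 'a) \<Rightarrow>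
     nat \<Rightarrow> nat \<Rightarrow> 'g \<Rightarrow> 'a \<Rightarrow> 'a" where
  "block_act G d T a b g = foldr (\<lambda>i \<phi>. coord_act G d T i g \<circ> \<phi>) [a..<Suc b] id"

definition H_sub :: "('g, 'b) monoid_scheme \<Rightarrow> nat \<Rightarrow> nat \<Rightarrow> (nat \<Rightarrow> 'g) set" where
  "H_sub G m d = {g \<in> carrier (gpow G d). \<forall>i\<in>{m<..d}. \<forall>k\<in>{m<..d}. g i = g k}"

definition L_sub :: "('g, 'b) monoid_scheme \<Rightarrow> nat \<Rightarrow> nat \<Rightarrow> (nat \<Rightarrow> 'g) set" where
  "L_sub G m d = {g \<in> H_sub G m d. \<forall>i\<in>{1..m}. g i = \<one>\<^bsub>G\<^esub>}"

section \<open>The tower\<close>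

text \<open>\<open>(g\<^sub>1, \<dots>, g\<^sub>m, h, \<dots>, h)\<close> acts by
  \<open>S\<^sub>1\<^bsup>g\<^sub>1\<^esup> \<cdots> S\<^bsub>m-1\<^esub>\<^bsup>g\<^bsub>m-1\<^esub>\<^esup> S\<^sub>[\<^sub>m\<^sub>;\<^sub>d\<^sub>]\<^bsup>g\<^sub>m\<^esup>\<close>, and trivially if \<open>m = 0\<close>.\<close>

definition tilde_act ::
  "('g, 'b) monoid_scheme \<Rightarrow> nat \<Rightarrow> ((nat \<Rightarrow> 'g) \<Rightarrow> 'a \<Rightarrow> 'a) \<Rightarrow>
     nat \<Rightarrow> (nat \<Rightarrow> 'g) \<Rightarrow> 'a \<Rightarrow> 'a" where
  "tilde_act G d S m g =
     (if m = 0 then id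
      else foldr (\<lambda>i \<phi>. coord_act G d S i (g i) \<circ> \<phi>) [1..<m] id \<circ> block_act G d S m d (g m))"

text \<open>The levels \<open>Y 0, \<dots>, Y d\<close> are arbitrary spaces with carriers inside one ambient type.
  The kernel \<open>\<kappa> j\<close> is the disintegration used to form the measure on \<open>Z (j + 1)\<close>;
  \<open>\<xi> (j + 1)\<close> and \<open>\<alpha> (j + 1)\<close> are the maps from \<open>Y (j + 1)\<close> to \<open>Y j\<close> and \<open>Z (j + 1)\<close>,
  and the coordinate projections of \<open>Z (j + 1)\<close> are \<^const>\<open>fst\<close> and \<^const>\<open>snd\<close>.\<close>

definition is_tower ::
  "('g, 'b) monoid_scheme \<Rightarrow> nat \<Rightarrow> (nat \<Rightarrow> 'a measure) \<Rightarrow>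
     (nat \<Rightarrow> (nat \<Rightarrow> 'g) \<Rightarrow> 'a \<Rightarrow> 'a) \<Rightarrow> (nat \<Rightarrow> 'a \<Rightarrow> 'a measure) \<Rightarrow>
     (nat \<Rightarrow> 'a \<Rightarrow> 'a) \<Rightarrow> (nat \<Rightarrow> 'a \<Rightarrow> 'a \<times> 'a) \<Rightarrow> bool" where
  "is_tower G d Y S \<kappa> \<xi> \<alpha> \<longleftrightarrow>
     (\<forall>j\<le>d. pmp_space (gpow G d) (Y j) (S j)) \<and>
     (\<forall>j<d. let m = d - j - 1 in
        disintegration (Y j) (inv_algebra (Y j) (S j) (L_sub G m d)) (\<kappa> j) \<and>
        factor_map (gpow G d) (Y (Suc j)) (S (Suc j)) (Y j) (S j) (\<xi> (Suc j)) \<and>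
        factor_map ((gpow G d)\<lparr>carrier := H_sub G m d\<rparr>) (Y (Suc j)) (S (Suc j))
          (rel_square (Y j) (\<kappa> j)) (\<lambda>g. map_prod (S j g) (tilde_act G d (S j) m g))
          (\<alpha> (Suc j)) \<and>
        (\<forall>y\<in>space (Y (Suc j)). \<xi> (Suc j) y = fst (\<alpha> (Suc j) y)))"

text \<open>\<open>\<pi>\<^sub>\<eta>\<^bsup>(j)\<^esup>\<close>, where \<open>\<eta> 1, \<dots>, \<eta> j\<close> are in \<open>{0, 1}\<close>.\<close>

primrec tower_proj :: "(nat \<Rightarrow> 'a \<Rightarrow> 'a \<times> 'a) \<Rightarrow> (nat \<Rightarrow> nat) \<Rightarrow> nat \<Rightarrow> 'a \<Rightarrow> 'a" where
  "tower_proj \<alpha> \<eta> 0 = id"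
| "tower_proj \<alpha> \<eta> (Suc j) =
     tower_proj \<alpha> \<eta> j \<circ> (if \<eta> (Suc j) = 0 then fst else snd) \<circ> \<alpha> (Suc j)"

definition ergodic_avg ::
  "('g, 'b) monoid_scheme \<Rightarrow> nat \<Rightarrow> ((nat \<Rightarrow> 'g) \<Rightarrow> 'a \<Rightarrow> 'a) \<Rightarrow> (nat \<Rightarrow> 'g set) \<Rightarrow>
     nat \<Rightarrow> (nat \<Rightarrow> 'a \<Rightarrow> complex) \<Rightarrow> nat \<Rightarrow> 'a \<Rightarrow> complex" where
  "ergodic_avg G d T F j f n x =
     (1 / of_nat (card (F n))) *
       (\<Sum>g\<in>F n. \<Prod>i\<in>{d - j + 1..d}. f i (block_act G d T (d - j + 1) i g x))"

definition cube_integral ::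
  "nat \<Rightarrow> 'a measure \<Rightarrow> (nat \<Rightarrow> 'a \<Rightarrow> 'a \<times> 'a) \<Rightarrow> ('a \<Rightarrow> complex) \<Rightarrow> complex" where
  "cube_integral j N \<alpha> f =
     (\<integral>y. (\<Prod>\<eta>\<in>{1..j} \<rightarrow>\<^sub>E {0, 1}.
            (cnj ^^ ((\<Sum>i\<in>{1..j}. \<eta> i) mod 2)) (f (tower_proj \<alpha> \<eta> j y))) \<partial>N)"

end

theory Submission
  imports Defs
begin

text \<open>
  The proof is by induction on \<open>j\<close>. For \<open>j = 1\<close> the mean ergodic theorem identifies the limit of
  \<open>\<parallel>\<Lambda>\<^sub>n(f\<^sub>d)\<parallel>\<^sup>2\<close> as the squared norm of the conditional expectation of \<open>f\<^sub>d\<close> on the almost invariant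
  sets, which is an integral over the relatively independent self-joining.
  In the induction step, van der Corput's inequality bounds \<open>\<parallel>\<Lambda>\<^sub>n(f\<^sub>a, \<dots>, f\<^sub>d)\<parallel>\<^sup>2\<close>, \<open>a = d - j\<close>,
  by an average over \<open>h, k\<close> of the norms \<open>\<parallel>\<Lambda>\<^sub>n(w\<^bsub>a+1\<^esub>, \<dots>, w\<^sub>d)\<parallel>\<close> with
  \<open>w\<^sub>i = f\<^sub>i(T\<^sub>[\<^sub>a\<^sub>;\<^sub>i\<^sub>]\<^sup>h x) \<cdot> cnj f\<^sub>i(T\<^sub>[\<^sub>a\<^sub>;\<^sub>i\<^sub>]\<^sup>k x)\<close>, to which the induction hypothesis applies. The maps
  \<open>\<pi>\<^sub>\<eta>\<close> intertwine \<open>S\<^sub>[\<^sub>a\<^sub>;\<^sub>d\<^sub>]\<close> on \<open>Y\<^sup>j\<close> with \<open>T\<^sub>[\<^sub>a\<^sub>;\<^sub>d\<^sub>]\<close>, so by concavity of \<open>t \<mapsto> t powr 2\<^sup>-\<^sup>j\<close> what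
  remains is a squared norm of an ergodic average of the cube function \<open>\<Phi>\<close> of \<open>f\<^sub>d\<close> on \<open>Y\<^sup>j\<close> along
  \<open>S\<^sub>[\<^sub>a\<^sub>;\<^sub>d\<^sub>]\<close>. The mean ergodic theorem turns its limit into \<open>\<integral>\<Phi> \<otimes> cnj \<Phi>\<close> over the self-joining of
  \<open>Y\<^sup>j\<close>, which is the cube integral on the next level.
\<close>

section \<open>Means over finite sets and bounded functions\<close>

text \<open>Real and complex values share one average. It is 0 on empty and on infinite index sets,
  which spares most of the rules a side condition.\<close>

definition mean :: "'i set \<Rightarrow> ('i \<Rightarrow> 'c::real_normed_field) \<Rightarrow> 'c" where
  "mean I u = (\<Sum>i\<in>I. u i) / of_nat (card I)"

lemma mean_cong: "(\<And>i. i \<in> I \<Longrightarrow> u i = v i) \<Longrightarrow> mean I u = mean I v"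
  by (simp add: mean_def)

lemma mean_const: "finite I \<Longrightarrow> I \<noteq> {} \<Longrightarrow> mean I (\<lambda>_. c) = c"
  by (simp add: mean_def)

lemma mean_diff: "mean I (\<lambda>i. u i - v i) = mean I u - mean I v"
  by (simp add: mean_def sum_subtractf diff_divide_distrib)

lemma mean_add: "mean I (\<lambda>i. u i + v i) = mean I u + mean I v"
  by (simp add: mean_def sum.distrib add_divide_distrib)

lemma mean_mult_left: "mean I (\<lambda>i. c * u i) = c * mean I u"
  by (simp add: mean_def sum_distrib_left[symmetric])

lemma mean_mult_right: "mean I (\<lambda>i. u i * c) = mean I u * c"
  by (simp add: mean_def sum_distrib_right[symmetric])

lemma mean_swap: "mean I (\<lambda>i. mean J (u i)) = mean J (\<lambda>j. mean I (\<lambda>i. u i j))"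
  unfolding mean_def by (simp add: sum_divide_distrib[symmetric]) (simp add: sum.swap[of _ J] mult.commute)

lemma mean_cnj: "cnj (mean I u) = mean I (\<lambda>i. cnj (u i))"
  by (simp add: mean_def)

lemma mean_Re: "Re (mean I u) = mean I (\<lambda>i. Re (u i))"
  by (simp add: mean_def)

lemma mean_mono:
  fixes u v :: "'i \<Rightarrow> real"
  shows "(\<And>i. i \<in> I \<Longrightarrow> u i \<le> v i) \<Longrightarrow> mean I u \<le> mean I v"
  by (auto simp: mean_def intro!: divide_right_mono sum_mono)

lemma norm_mean_le: "norm (mean I u) \<le> mean I (\<lambda>i. norm (u i))"
  by (auto simp: mean_def norm_divide intro!: divide_right_mono sum_norm_le)

lemma mean_le_bound:
  fixes u :: "'i \<Rightarrow> real"
  assumes "\<And>i. i \<in> I \<Longrightarrow> u i \<le> c" "0 \<le> c"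
  shows "mean I u \<le> c"
proof (cases "finite I \<and> I \<noteq> {}")
  case True
  then show ?thesis using mean_mono[of I u "\<lambda>_. c"] assms by (simp add: mean_const)
next
  case False
  then show ?thesis using assms by (auto simp: mean_def)
qed

lemma norm_mean_le_bound:
  assumes "\<And>i. i \<in> I \<Longrightarrow> norm (u i) \<le> c" "0 \<le> c"
  shows "norm (mean I u) \<le> c"
  using order_trans[OF norm_mean_le mean_le_bound[of I "\<lambda>i. norm (u i)" c]] assms by blast

lemma square_mean_le:
  fixes u :: "'i \<Rightarrow> real"
  shows "(mean I u)\<^sup>2 \<le> mean I (\<lambda>i. (u i)\<^sup>2)"
proof (cases "card I = 0")
  case False
  then show ?thesis
    using sum_squared_le_sum_of_squares[of u I]
    by (simp add: mean_def power_divide divide_simps power2_eq_square mult_ac)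
qed (simp add: mean_def)

lemma norm_mean_square_le: "(norm (mean I u))\<^sup>2 \<le> mean I (\<lambda>i. (norm (u i))\<^sup>2)"
  using power_mono[OF norm_mean_le norm_ge_zero, of I u 2] square_mean_le[of I "\<lambda>i. norm (u i)"]
  by linarith

text \<open>Jensen's inequality for \<open>t ^ (2 ^ k)\<close>, obtained by applying Cauchy-Schwarz
  once for each of the \<open>k\<close> squarings.\<close>

lemma power_mean_le:
  fixes u :: "'i \<Rightarrow> real"
  assumes "\<And>i. i \<in> I \<Longrightarrow> 0 \<le> u i"
  shows "(mean I u) ^ (2 ^ k) \<le> mean I (\<lambda>i. u i ^ (2 ^ k))"
proof (induction k)
  case (Suc k)
  have "0 \<le> mean I u"
    using assms by (simp add: mean_def sum_nonneg)
  then have "(mean I u) ^ (2 ^ Suc k) \<le> (mean I (\<lambda>i. u i ^ (2 ^ k)))\<^sup>2"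
    using Suc power_mono[of "(mean I u) ^ (2 ^ k)" _ 2] by (simp add: power_mult[symmetric] mult.commute)
  also have "\<dots> \<le> mean I (\<lambda>i. (u i ^ (2 ^ k))\<^sup>2)"
    by (rule square_mean_le)
  finally show ?case
    by (simp add: power_mult[symmetric] mult.commute)
qed simp

lemma mean_measurable:
  assumes "\<And>i. i \<in> I \<Longrightarrow> u i \<in> borel_measurable M"
  shows "(\<lambda>x. mean I (\<lambda>i. u i x)::complex) \<in> borel_measurable M"
  using assms unfolding mean_def by measurable

lemma integral_mean:
  fixes u :: "'i \<Rightarrow> 'a \<Rightarrow> 'c::{real_normed_field, banach, second_countable_topology}"
  assumes "\<And>i. i \<in> I \<Longrightarrow> integrable M (u i)"
  shows "(\<integral>x. mean I (\<lambda>i. u i x) \<partial>M) = mean I (\<lambda>i. \<integral>x. u i x \<partial>M)"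
  using assms by (simp add: mean_def Bochner_Integration.integral_sum)

text \<open>Concavity of \<open>t powr (1 / 2 ^ j)\<close> for iterated means. Raised to the power
  \<open>2 ^ j\<close>, it becomes two applications of \<open>power_mean_le\<close>, one for each
  mean.\<close>

lemma mean_mean_powr_le:
  fixes b :: "'i \<Rightarrow> 'k \<Rightarrow> real"
  assumes "\<And>h k. h \<in> I \<Longrightarrow> k \<in> J \<Longrightarrow> 0 \<le> b h k"
  shows "mean I (\<lambda>h. mean J (\<lambda>k. b h k powr (1 / 2 ^ j))) \<le> mean I (\<lambda>h. mean J (b h)) powr (1 / 2 ^ j)"
proof -
  let ?m = "mean I (\<lambda>h. mean J (\<lambda>k. b h k powr (1 / 2 ^ j)))"
  have pw: "(x powr (1 / 2 ^ j)) ^ (2 ^ j) = x" if "0 \<le> x" for x :: real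
    using that by (cases "x = 0") (simp_all add: powr_realpow[symmetric] powr_powr)
  have m0: "0 \<le> ?m" by (auto simp: mean_def intro!: divide_nonneg_nonneg sum_nonneg)
  have "?m ^ (2 ^ j) \<le> mean I (\<lambda>h. mean J (\<lambda>k. b h k powr (1 / 2 ^ j)) ^ (2 ^ j))"
    by (rule power_mean_le) (auto simp: mean_def intro!: divide_nonneg_nonneg sum_nonneg)
  also have "\<dots> \<le> mean I (\<lambda>h. mean J (\<lambda>k. (b h k powr (1 / 2 ^ j)) ^ (2 ^ j)))"
    by (intro mean_mono power_mean_le) auto
  also have "\<dots> = mean I (\<lambda>h. mean J (b h))"
    using assms by (intro mean_cong) (simp add: pw)
  finally have "(?m ^ (2 ^ j)) powr (1 / 2 ^ j) \<le> mean I (\<lambda>h. mean J (b h)) powr (1 / 2 ^ j)"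
    using m0 by (intro powr_mono2) auto
  moreover have "(?m ^ (2 ^ j)) powr (1 / 2 ^ j) = ?m"
    using m0 by (cases "?m = 0") (simp_all add: powr_realpow[symmetric] powr_powr)
  ultimately show ?thesis by simp
qed

text \<open>The difference of the squares factors into \<open>cmod a + cmod b\<close>, at most 2,
  and \<open>cmod a - cmod b\<close>, at most \<open>e / 2\<close>.\<close>

lemma square_norm_le_of_close:
  assumes "cmod a \<le> 1" "cmod b \<le> 1" "cmod (b - a) \<le> e / 2"
  shows "(cmod a)\<^sup>2 \<le> (cmod b)\<^sup>2 + e"
proof -
  have e: "0 \<le> e" using assms(3) norm_ge_zero[of "b - a"] by linarith
  have "cmod a - cmod b \<le> e / 2"
    using norm_triangle_ineq2[of a b] assms(3) by (simp add: norm_minus_commute)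
  then have "(cmod a + cmod b) * (cmod a - cmod b) \<le> 2 * (e / 2)"
    using assms e mult_mono[of "cmod a + cmod b" 2 "cmod a - cmod b" "e / 2"]
      mult_nonneg_nonpos[of "cmod a + cmod b" "cmod a - cmod b"]
    by (cases "cmod a - cmod b \<ge> 0") auto
  then show ?thesis
    by (simp add: algebra_simps power2_eq_square)
qed

text \<open>Left translation by \<open>k\<close> turns the first mean into one over the translated
  set. The two sums cancel on the intersection, and each element of the symmetric difference
  contributes at most 1.\<close>

lemma Folner_shift_le:
  assumes "group G" "left_Folner G F" "k \<in> carrier G" and u: "\<And>g. g \<in> carrier G \<Longrightarrow> cmod (u g) \<le> 1"
  shows "cmod (mean (F n) (\<lambda>g. u (k \<otimes>\<^bsub>G\<^esub> g)) - mean (F n) u)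
    \<le> real (card (sym_diff (k <#\<^bsub>G\<^esub> F n) (F n))) / real (card (F n))"
proof -
  interpret group G by fact
  let ?E = "F n" and ?K = "k <#\<^bsub>G\<^esub> F n"
  have fin: "finite ?E" and ne: "?E \<noteq> {}" and sub: "?E \<subseteq> carrier G"
    using assms(2) by (auto simp: left_Folner_def)
  have K: "?K = (\<lambda>g. k \<otimes>\<^bsub>G\<^esub> g) ` ?E"
    by (auto simp: l_coset_def)
  have inj: "inj_on (\<lambda>g. k \<otimes>\<^bsub>G\<^esub> g) ?E"
    using sub assms(3) by (auto simp: inj_on_def subset_iff)
  have finK: "finite ?K" and subK: "?K \<subseteq> carrier G"
    using fin sub assms(3) by (auto simp: K)
  have "(\<Sum>g\<in>?E. u (k \<otimes>\<^bsub>G\<^esub> g)) = sum u ?K"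
    by (simp add: K sum.reindex[OF inj] o_def)
  also have "\<dots> - sum u ?E = sum u (?K - ?E) - sum u (?E - ?K)"
    using sum.Int_Diff[OF finK, of u ?E] sum.Int_Diff[OF fin, of u ?K] by (simp add: Int_commute)
  also have "cmod \<dots> \<le> real (card (?K - ?E)) + real (card (?E - ?K))"
  proof -
    have "cmod (sum u (?K - ?E)) \<le> real (card (?K - ?E)) * 1"
      by (rule sum_norm_bound) (use u subK in auto)
    moreover have "cmod (sum u (?E - ?K)) \<le> real (card (?E - ?K)) * 1"
      by (rule sum_norm_bound) (use u sub in auto)
    ultimately show ?thesis
      using norm_triangle_ineq4[of "sum u (?K - ?E)" "sum u (?E - ?K)"] by linarith
  qed
  also have "\<dots> = real (card (sym_diff ?K ?E))"
    using fin finK by (subst card_Un_disjoint) auto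
  finally show ?thesis
    by (simp add: mean_def diff_divide_distrib[symmetric] norm_divide divide_right_mono)
qed

text \<open>Bounded functions are normalised to take values in the unit disc everywhere, so that
  they remain bounded along every orbit.\<close>

definition unit_meas :: "'a measure \<Rightarrow> ('a \<Rightarrow> complex) set" where
  "unit_meas M = {f \<in> borel_measurable M. \<forall>x. cmod (f x) \<le> 1}"

lemma unit_measD:
  assumes "f \<in> unit_meas M"
  shows unit_meas_measurable: "f \<in> borel_measurable M" and unit_meas_le: "cmod (f x) \<le> 1"
  using assms by (auto simp: unit_meas_def)

lemma unit_meas_comp: "f \<in> unit_meas N \<Longrightarrow> t \<in> M \<rightarrow>\<^sub>M N \<Longrightarrow> (\<lambda>x. f (t x)) \<in> unit_meas M"
  by (auto simp: unit_meas_def)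

lemma unit_meas_mult: "f \<in> unit_meas M \<Longrightarrow> g \<in> unit_meas M \<Longrightarrow> (\<lambda>x. f x * g x) \<in> unit_meas M"
  by (auto simp: unit_meas_def norm_mult mult_le_one)

lemma unit_meas_cnj: "f \<in> unit_meas M \<Longrightarrow> (\<lambda>x. cnj (f x)) \<in> unit_meas M"
  by (auto simp: unit_meas_def intro: borel_measurable_continuous_on continuous_intros)

lemma unit_meas_prod: "(\<And>i. i \<in> I \<Longrightarrow> f i \<in> unit_meas M) \<Longrightarrow> (\<lambda>x. \<Prod>i\<in>I. f i x) \<in> unit_meas M"
  by (auto simp: unit_meas_def prod_norm[symmetric] intro!: prod_le_1 borel_measurable_prod)

lemma unit_meas_mean: "(\<And>i. i \<in> I \<Longrightarrow> f i \<in> unit_meas M) \<Longrightarrow> (\<lambda>x. mean I (\<lambda>i. f i x)) \<in> unit_meas M"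
  by (auto simp: unit_meas_def intro!: norm_mean_le_bound mean_measurable)

lemma (in finite_measure) unit_meas_integrable:
  assumes "f \<in> unit_meas M"
  shows "integrable M f"
  using unit_measD[OF assms] by (intro integrable_const_bound[where B=1]) auto

lemma (in finite_measure) unit_meas_sq_integrable:
  assumes "f \<in> unit_meas M"
  shows "integrable M (\<lambda>x. (cmod (f x))\<^sup>2)"
  using unit_measD[OF assms] by (intro integrable_const_bound[where B=1]) (auto simp: power_le_one)

text \<open>The variance of \<open>cmod (B x)\<close> is nonnegative.\<close>

lemma (in prob_space) L1_square_le:
  fixes B :: "'a \<Rightarrow> complex"
  assumes [measurable]: "B \<in> borel_measurable M" and "integrable M (\<lambda>x. (cmod (B x))\<^sup>2)"
  shows "(\<integral>x. cmod (B x) \<partial>M)\<^sup>2 \<le> (\<integral>x. (cmod (B x))\<^sup>2 \<partial>M)"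
proof -
  have "integrable M (\<lambda>x. cmod (B x))"
    by (rule square_integrable_imp_integrable) (use assms in auto)
  then show ?thesis
    using variance_eq[of "\<lambda>x. cmod (B x)"] variance_positive[of "\<lambda>x. cmod (B x)"] assms(2)
    by simp
qed

text \<open>The bounded factor \<open>w\<close> can be discarded in the L1 norm, which is at most
  the L2 norm under a probability measure.\<close>

lemma (in prob_space) integral_mult_le_l2_norm:
  assumes w: "w \<in> unit_meas M" and v: "v \<in> unit_meas M"
  shows "Re (\<integral>x. w x * v x \<partial>M) \<le> l2_norm M v"
proof -
  have "Re (\<integral>x. w x * v x \<partial>M) \<le> cmod (\<integral>x. w x * v x \<partial>M)" by (rule complex_Re_le_cmod)
  also have "\<dots> \<le> (\<integral>x. cmod (w x * v x) \<partial>M)" by (rule integral_norm_bound)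
  also have "\<dots> \<le> (\<integral>x. cmod (v x) \<partial>M)"
    using w v unit_meas_le[OF w]
    by (intro integral_mono integrable_norm unit_meas_integrable unit_meas_mult)
      (auto simp: norm_mult intro: mult_left_le_one_le)
  also have "\<dots> \<le> l2_norm M v"
    unfolding l2_norm_def
    by (intro real_le_rsqrt L1_square_le unit_meas_measurable[OF v] unit_meas_sq_integrable[OF v])
  finally show ?thesis .
qed

section \<open>The mean ergodic theorem\<close>

text \<open>The action rules are pointwise on \<open>space M\<close>, free of the restrictions that
  \<open>group_action\<close> brings, so that orbits can be computed directly.\<close>

locale pmp_action = group G + prob_space M
  for G :: "('g, 'b) monoid_scheme" (structure) and M :: "'a measure" +
  fixes S :: "'g \<Rightarrow> 'a \<Rightarrow> 'a"
  assumes act_measurable[measurable]: "g \<in> carrier G \<Longrightarrow> S g \<in> M \<rightarrow>\<^sub>M M"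
    and act_distr: "g \<in> carrier G \<Longrightarrow> distr M M (S g) = M"
    and act_mult: "g \<in> carrier G \<Longrightarrow> h \<in> carrier G \<Longrightarrow> x \<in> space M \<Longrightarrow> S (g \<otimes> h) x = S g (S h x)"
    and act_one: "x \<in> space M \<Longrightarrow> S \<one> x = x"
begin

lemma act_space: "g \<in> carrier G \<Longrightarrow> x \<in> space M \<Longrightarrow> S g x \<in> space M"
  using measurable_space[OF act_measurable] .

lemma integral_act:
  fixes f :: "'a \<Rightarrow> 'c::{banach, second_countable_topology}"
  assumes "g \<in> carrier G" "f \<in> borel_measurable M"
  shows "(\<integral>x. f (S g x) \<partial>M) = (\<integral>x. f x \<partial>M)"
  using integral_distr[of "S g" M M f] assms by (simp add: act_measurable act_distr)

definition orbit_mean :: "'g set \<Rightarrow> ('a \<Rightarrow> complex) \<Rightarrow> 'a \<Rightarrow> complex" where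
  "orbit_mean E f x = mean E (\<lambda>g. f (S g x))"

lemma orbit_mean_unit:
  assumes "f \<in> unit_meas M" "E \<subseteq> carrier G"
  shows "orbit_mean E f \<in> unit_meas M"
  unfolding orbit_mean_def[abs_def] using assms by (intro unit_meas_mean unit_meas_comp[OF assms(1)]) auto

end

locale Folner_pmp_action = pmp_action G M S
  for G :: "('g, 'b) monoid_scheme" (structure) and M :: "'a measure" and S +
  fixes F :: "nat \<Rightarrow> 'g set" and f :: "'a \<Rightarrow> complex"
  assumes Folner: "left_Folner G F" and f_unit: "f \<in> unit_meas M"
begin

lemma F_finite: "finite (F n)" and F_nonempty: "F n \<noteq> {}" and F_carrier: "F n \<subseteq> carrier G"
  using Folner by (auto simp: left_Folner_def)

lemma F_in: "g \<in> F n \<Longrightarrow> g \<in> carrier G"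
  using F_carrier by auto

abbreviation A :: "nat \<Rightarrow> ('a \<Rightarrow> complex) \<Rightarrow> 'a \<Rightarrow> complex" where
  "A n \<equiv> orbit_mean (F n)"

text \<open>The functions in the convex hull of the orbit of \<open>f\<close> have this property, and it is all
  that is needed of them.\<close>

definition same_mean :: "('a \<Rightarrow> complex) \<Rightarrow> bool" where
  "same_mean B \<longleftrightarrow> B \<in> unit_meas M \<and>
     (\<forall>e>0. \<forall>\<^sub>F n in sequentially. \<forall>x\<in>space M. cmod (A n B x - A n f x) \<le> e)"

lemma same_meanI:
  assumes "B \<in> unit_meas M"
    and "\<And>e. e > 0 \<Longrightarrow> \<forall>\<^sub>F n in sequentially. \<forall>x\<in>space M. cmod (A n B x - A n f x) \<le> e"
  shows "same_mean B"
  using assms by (simp add: same_mean_def)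

text \<open>The averages of \<open>f\<close> composed with \<open>S k\<close> run over
  \<open>f (S (k \<otimes> g) x)\<close>. This is a left translate, so the left Folner property
  makes the difference vanish uniformly in \<open>x\<close>.\<close>

lemma same_mean_orbit:
  assumes k: "k \<in> carrier G"
  shows "same_mean (\<lambda>x. f (S k x))"
proof (rule same_meanI)
  show "(\<lambda>x. f (S k x)) \<in> unit_meas M"
    using k by (intro unit_meas_comp[OF f_unit]) auto
  fix e :: real assume "e > 0"
  have "(\<lambda>n. real (card (sym_diff (k <#\<^bsub>G\<^esub> F n) (F n))) / real (card (F n))) \<longlonglongrightarrow> 0"
    using Folner k by (auto simp: left_Folner_def)
  then have "\<forall>\<^sub>F n in sequentially. real (card (sym_diff (k <#\<^bsub>G\<^esub> F n) (F n))) / real (card (F n)) < e"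
    using \<open>e > 0\<close> by (rule order_tendstoD)
  then show "\<forall>\<^sub>F n in sequentially. \<forall>x\<in>space M. cmod (A n (\<lambda>x. f (S k x)) x - A n f x) \<le> e"
  proof eventually_elim
    case (elim n)
    show ?case
    proof
      fix x assume x: "x \<in> space M"
      have "A n (\<lambda>x. f (S k x)) x = mean (F n) (\<lambda>g. f (S (k \<otimes> g) x))"
        unfolding orbit_mean_def using x k by (intro mean_cong) (simp add: act_mult F_in)
      then show "cmod (A n (\<lambda>x. f (S k x)) x - A n f x) \<le> e"
        using Folner_shift_le[OF is_group Folner k, of "\<lambda>g. f (S g x)" n] unit_meas_le[OF f_unit] elim
        by (simp add: orbit_mean_def)
    qed
  qed
qed

text \<open>Averaging along orbits commutes with the mean over \<open>I\<close>, and finitely many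
  eventual bounds hold simultaneously.\<close>

lemma same_mean_mean:
  assumes "finite I" "I \<noteq> {}" and B: "\<And>i. i \<in> I \<Longrightarrow> same_mean (B i)"
  shows "same_mean (\<lambda>x. mean I (\<lambda>i. B i x))"
proof (rule same_meanI)
  show "(\<lambda>x. mean I (\<lambda>i. B i x)) \<in> unit_meas M"
    using B by (intro unit_meas_mean) (auto simp: same_mean_def)
  fix e :: real assume "e > 0"
  have "\<forall>\<^sub>F n in sequentially. \<forall>i\<in>I. \<forall>x\<in>space M. cmod (A n (B i) x - A n f x) \<le> e"
    using B \<open>e > 0\<close> by (intro eventually_ball_finite assms) (auto simp: same_mean_def)
  then show "\<forall>\<^sub>F n in sequentially. \<forall>x\<in>space M. cmod (A n (\<lambda>x. mean I (\<lambda>i. B i x)) x - A n f x) \<le> e"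
  proof eventually_elim
    case (elim n)
    show ?case
    proof
      fix x assume x: "x \<in> space M"
      have "A n (\<lambda>x. mean I (\<lambda>i. B i x)) x - A n f x = mean I (\<lambda>i. A n (B i) x - A n f x)"
        unfolding orbit_mean_def mean_diff mean_const[OF assms(1,2)]
        using mean_swap[of "F n" I "\<lambda>g i. B i (S g x)"] by simp
      also have "cmod \<dots> \<le> e"
        using elim x \<open>e > 0\<close> by (intro norm_mean_le_bound) auto
      finally show "cmod (A n (\<lambda>x. mean I (\<lambda>i. B i x)) x - A n f x) \<le> e" .
    qed
  qed
qed

lemma same_mean_midpoint:
  assumes "same_mean B" "same_mean C"
  shows "same_mean (\<lambda>x. (B x + C x) / 2)"
proof -
  \<comment> \<open>A midpoint is a mean over a two-element index set.\<close>
  have "same_mean (\<lambda>x. mean (UNIV::bool set) (\<lambda>i. (if i then B else C) x))"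
    using assms by (intro same_mean_mean) auto
  then show ?thesis
    by (simp add: mean_def UNIV_bool add.commute)
qed

lemma same_mean_avg: "same_mean (A n f)"
  using same_mean_mean[of "F n" "\<lambda>g x. f (S g x)"] same_mean_orbit F_finite F_nonempty F_in
  by (simp add: orbit_mean_def[abs_def])

lemma same_mean_avg_shift:
  assumes "g \<in> carrier G"
  shows "same_mean (\<lambda>x. A n f (S g x))"
proof -
  have "same_mean (\<lambda>x. f (S h (S g x)))" if "h \<in> F n" for h
  proof -
    have *: "f (S h (S g x)) = f (S (h \<otimes> g) x)" if "x \<in> space M" for x
      using \<open>h \<in> F n\<close> assms that by (simp add: act_mult F_in)
    \<comment> \<open>The functions agree only on \<open>space M\<close>, but
      \<open>same_mean\<close> compares averages only there, so the property carries over.\<close>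
    have "A m (\<lambda>x. f (S h (S g x))) x = A m (\<lambda>x. f (S (h \<otimes> g) x)) x" if "x \<in> space M" for x m
      using that unfolding orbit_mean_def by (intro mean_cong *) (auto simp: act_space F_in)
    moreover have "(\<lambda>x. f (S h (S g x))) \<in> unit_meas M"
      using f_unit assms \<open>h \<in> F n\<close> F_in by (intro unit_meas_comp[OF f_unit]) measurable
    ultimately show ?thesis
      using same_mean_orbit[of "h \<otimes> g"] assms \<open>h \<in> F n\<close> F_in[of h n] by (simp add: same_mean_def)
  qed
  then show ?thesis
    using same_mean_mean[of "F n" "\<lambda>h x. f (S h (S g x))"] F_finite F_nonempty
    by (simp add: orbit_mean_def[abs_def])
qed

section \<open>Squared norms of the averages and their infimum\<close>

definition sq :: "('a \<Rightarrow> complex) \<Rightarrow> real" where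
  "sq B = (\<integral>x. (cmod (B x))\<^sup>2 \<partial>M)"

lemma sq_nonneg: "0 \<le> sq B"
  by (simp add: sq_def)

text \<open>Jensen's inequality for the mean over \<open>F n\<close>, then invariance of the measure
  for each term.\<close>

lemma sq_avg_le:
  assumes B: "B \<in> unit_meas M"
  shows "sq (A n B) \<le> sq B"
proof -
  have i: "integrable M (\<lambda>x. (cmod (B (S g x)))\<^sup>2)" if "g \<in> F n" for g
    using that B F_in by (intro unit_meas_sq_integrable unit_meas_comp[OF B]) auto
  have "sq (A n B) \<le> (\<integral>x. mean (F n) (\<lambda>g. (cmod (B (S g x)))\<^sup>2) \<partial>M)"
    unfolding sq_def orbit_mean_def
    using unit_meas_sq_integrable[OF orbit_mean_unit[OF B F_carrier]] i
    by (intro integral_mono norm_mean_square_le) (auto simp: orbit_mean_def mean_def)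
  also have "\<dots> = mean (F n) (\<lambda>g. sq B)"
  proof -
    have "(\<lambda>x. (cmod (B x))\<^sup>2) \<in> borel_measurable M"
      using unit_meas_measurable[OF B] by simp
    then show ?thesis
      by (subst integral_mean[OF i], simp)
        (intro mean_cong, simp add: sq_def integral_act[OF F_in, where f = "\<lambda>x. (cmod (B x))\<^sup>2"])
  qed
  finally show ?thesis
    by (simp add: mean_const F_finite F_nonempty)
qed

text \<open>Eventually \<open>A n f\<close> is uniformly close to \<open>A n B\<close>, and
  averaging does not increase the norm of \<open>B\<close>.\<close>

lemma sq_avg_eventually_le:
  assumes "same_mean B" "e > 0"
  shows "\<forall>\<^sub>F n in sequentially. sq (A n f) \<le> sq B + e"
proof -
  have B: "B \<in> unit_meas M"
    using assms(1) by (simp add: same_mean_def)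
  have "\<forall>\<^sub>F n in sequentially. \<forall>x\<in>space M. cmod (A n B x - A n f x) \<le> e / 2"
    using assms half_gt_zero[OF assms(2)] unfolding same_mean_def by blast
  then show ?thesis
  proof eventually_elim
    case (elim n)
    have uB: "A n B \<in> unit_meas M" and uf: "A n f \<in> unit_meas M"
      using B f_unit F_carrier by (auto intro: orbit_mean_unit)
    have "(cmod (A n f x))\<^sup>2 \<le> (cmod (A n B x))\<^sup>2 + e" if "x \<in> space M" for x
      using elim that by (intro square_norm_le_of_close unit_meas_le[OF uB] unit_meas_le[OF uf]) auto
    then have "sq (A n f) \<le> (\<integral>x. (cmod (A n B x))\<^sup>2 + e \<partial>M)"
      unfolding sq_def using unit_meas_sq_integrable[OF uB] unit_meas_sq_integrable[OF uf]
      by (intro integral_mono) auto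
    also have "\<dots> = sq (A n B) + e"
      unfolding sq_def using unit_meas_sq_integrable[OF uB] by (simp add: prob_space)
    also have "\<dots> \<le> sq B + e"
      using sq_avg_le[OF B, of n] by simp
    finally show ?case .
  qed
qed

definition inf_sq :: real where
  "inf_sq = (INF n. sq (A n f))"

lemma inf_sq_le_avg: "inf_sq \<le> sq (A n f)"
  unfolding inf_sq_def by (rule cINF_lower) (auto intro!: bdd_belowI2[of _ 0] simp: sq_nonneg)

text \<open>The infimum over the averages alone is a lower bound for all functions with the same
  means. This larger class contains the midpoints that the parallelogram law requires.\<close>

lemma inf_sq_le:
  assumes "same_mean B"
  shows "inf_sq \<le> sq B"
proof (rule field_le_epsilon)
  fix e :: real assume "e > 0"
  then obtain n where "sq (A n f) \<le> sq B + e"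
    using sq_avg_eventually_le[OF assms] eventually_happens'[OF sequentially_bot] by blast
  then show "inf_sq \<le> sq B + e"
    using inf_sq_le_avg[of n] by linarith
qed

text \<open>A nearly minimal average has the same means as \<open>f\<close>, so its squared norm
  eventually bounds that of all averages up to a small error.\<close>

lemma sq_avg_tendsto: "(\<lambda>n. sq (A n f)) \<longlonglongrightarrow> inf_sq"
proof (rule order_tendstoI)
  fix a assume "a < inf_sq"
  then show "\<forall>\<^sub>F n in sequentially. a < sq (A n f)"
    using inf_sq_le_avg by (intro always_eventually) (auto intro: less_le_trans)
next
  fix a assume a: "inf_sq < a"
  then obtain m where m: "sq (A m f) < a"
    unfolding inf_sq_def by (subst (asm) cINF_less_iff) (auto intro!: bdd_belowI2[of _ 0] simp: sq_nonneg)
  \<comment> \<open>Only half of the gap is given away, so that the bound stays strictly below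
    \<open>a\<close>.\<close>
  have "\<forall>\<^sub>F n in sequentially. sq (A n f) \<le> sq (A m f) + (a - sq (A m f)) / 2"
    using m by (intro sq_avg_eventually_le same_mean_avg) auto
  then show "\<forall>\<^sub>F n in sequentially. sq (A n f) < a"
    by (rule eventually_mono) (use m in \<open>simp add: field_simps\<close>)
qed

text \<open>By the parallelogram law, nearly minimal functions are close to each other. This gives both
  the convergence of the averages and the invariance of their limit.\<close>

lemma sq_diff_le:
  assumes "same_mean B" "same_mean C"
  shows "sq (\<lambda>x. B x - C x) \<le> 2 * sq B + 2 * sq C - 4 * inf_sq"
proof -
  have u: "B \<in> unit_meas M" "C \<in> unit_meas M" "(\<lambda>x. (B x + C x) / 2) \<in> unit_meas M"
    using assms same_mean_midpoint[OF assms] by (auto simp: same_mean_def)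
  note i = u[THEN unit_meas_sq_integrable]
  have "(cmod (B x - C x))\<^sup>2 = 2 * (cmod (B x))\<^sup>2 + 2 * (cmod (C x))\<^sup>2 - 4 * (cmod ((B x + C x) / 2))\<^sup>2" for x
  proof -
    have "(cmod (b - c))\<^sup>2 = 2 * (cmod b)\<^sup>2 + 2 * (cmod c)\<^sup>2 - (cmod (b + c))\<^sup>2" for b c
      unfolding cmod_power2 minus_complex.sel plus_complex.sel by algebra
    then show ?thesis
      by (simp add: norm_divide power_divide)
  qed
  then have "sq (\<lambda>x. B x - C x) = 2 * sq B + 2 * sq C - 4 * sq (\<lambda>x. (B x + C x) / 2)"
    unfolding sq_def using i by simp
  then show ?thesis
    using inf_sq_le[OF same_mean_midpoint[OF assms]] by linarith
qed

end

section \<open>Almost invariant sets and functions\<close>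

context pmp_action
begin

text \<open>\<open>inv_algebra\<close> is phrased with images. Rewritten as preimages under the
  inverse, they are visibly measurable.\<close>

lemma image_act:
  assumes "g \<in> carrier G" "B \<subseteq> space M"
  shows "S g ` B = {x \<in> space M. S (inv g) x \<in> B}"
proof safe
  fix x assume "x \<in> B"
  then have x: "x \<in> space M" using assms by auto
  then show "S g x \<in> space M" using assms by (simp add: act_space)
  show "S (inv g) (S g x) \<in> B"
    using x \<open>x \<in> B\<close> assms by (simp add: act_mult[symmetric] act_one)
next
  fix x assume x: "x \<in> space M" "S (inv g) x \<in> B"
  then have "x = S g (S (inv g) x)"
    using assms by (simp add: act_mult[symmetric] act_one)
  then show "x \<in> S g ` B" using x by blast
qed

lemma null_sym_diff_image_iff:
  assumes "g \<in> carrier G" and B: "B \<in> sets M"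
  shows "emeasure M (sym_diff (S g ` B) B) = 0 \<longleftrightarrow> (AE x in M. S (inv g) x \<in> B \<longleftrightarrow> x \<in> B)"
proof -
  have BM: "B \<subseteq> space M" using B by (rule sets.sets_into_space)
  have [measurable]: "S (inv g) \<in> M \<rightarrow>\<^sub>M M" using assms by simp
  have eq: "sym_diff (S g ` B) B = {x \<in> space M. \<not> (S (inv g) x \<in> B \<longleftrightarrow> x \<in> B)}"
    using BM by (auto simp: image_act[OF assms(1) BM])
  have "{x \<in> space M. \<not> (S (inv g) x \<in> B \<longleftrightarrow> x \<in> B)} \<in> sets M"
    using B by measurable
  then show ?thesis
    unfolding eq by (subst AE_iff_measurable[OF _ refl]) auto
qed

text \<open>The almost invariant sets already form a \<sigma>-algebra, so passing to the generated
  one adds no sets.\<close>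

lemma sets_inv_algebra_iff:
  "B \<in> sets (inv_algebra M S (carrier G)) \<longleftrightarrow>
     B \<in> sets M \<and> (\<forall>g\<in>carrier G. AE x in M. S g x \<in> B \<longleftrightarrow> x \<in> B)"
proof -
  let ?I = "{B \<in> sets M. \<forall>g\<in>carrier G. AE x in M. S g x \<in> B \<longleftrightarrow> x \<in> B}"
  have gen: "{B \<in> sets M. \<forall>h\<in>carrier G. emeasure M (sym_diff (S h ` B) B) = 0} = ?I"
    (is "?J = _")
  proof (intro Collect_cong conj_cong refl)
    fix B assume B: "B \<in> sets M"
    have "(\<forall>h\<in>carrier G. emeasure M (sym_diff (S h ` B) B) = 0) \<longleftrightarrow>
        (\<forall>h\<in>carrier G. AE x in M. S (inv h) x \<in> B \<longleftrightarrow> x \<in> B)"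
      using B by (simp add: null_sym_diff_image_iff)
    \<comment> \<open>Inversion permutes the group.\<close>
    also have "\<dots> \<longleftrightarrow> (\<forall>h\<in>carrier G. AE x in M. S h x \<in> B \<longleftrightarrow> x \<in> B)"
      by (metis inv_closed inv_inv)
    finally show "(\<forall>h\<in>carrier G. emeasure M (sym_diff (S h ` B) B) = 0) \<longleftrightarrow>
        (\<forall>h\<in>carrier G. AE x in M. S h x \<in> B \<longleftrightarrow> x \<in> B)" .
  qed
  have "sigma_algebra (space M) ?I"
  proof (rule sigma_algebra.intro[OF algebra_iff_Un[THEN iffD2]]; (unfold_locales)?)
    show "?I \<subseteq> Pow (space M) \<and> {} \<in> ?I \<and> (\<forall>a\<in>?I. space M - a \<in> ?I) \<and> (\<forall>a\<in>?I. \<forall>b\<in>?I. a \<union> b \<in> ?I)"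
    proof (intro conjI ballI)
      show "?I \<subseteq> Pow (space M)" using sets.sets_into_space by auto
      show "{} \<in> ?I" by simp
      fix a assume a: "a \<in> ?I"
      have "AE x in M. S g x \<in> space M - a \<longleftrightarrow> x \<in> space M - a" if "g \<in> carrier G" for g
      proof -
        have "AE x in M. S g x \<in> a \<longleftrightarrow> x \<in> a" using a that by simp
        then show ?thesis using AE_space by eventually_elim (use that in \<open>auto simp: act_space\<close>)
      qed
      then show "space M - a \<in> ?I" using a by auto
      fix b assume b: "b \<in> ?I"
      have "AE x in M. S g x \<in> a \<union> b \<longleftrightarrow> x \<in> a \<union> b" if "g \<in> carrier G" for g
      proof -
        have "AE x in M. S g x \<in> a \<longleftrightarrow> x \<in> a" "AE x in M. S g x \<in> b \<longleftrightarrow> x \<in> b" using a b that by simp_all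
        then show ?thesis by eventually_elim auto
      qed
      then show "a \<union> b \<in> ?I" using a b by auto
    qed
    fix B :: "nat \<Rightarrow> 'a set" assume B: "range B \<subseteq> ?I"
    have "AE x in M. S g x \<in> (\<Union>i. B i) \<longleftrightarrow> x \<in> (\<Union>i. B i)" if "g \<in> carrier G" for g
    proof -
      \<comment> \<open>A countable union of exceptional null sets is null.\<close>
      have "AE x in M. \<forall>i. S g x \<in> B i \<longleftrightarrow> x \<in> B i"
        using B that by (subst AE_all_countable) auto
      then show ?thesis by eventually_elim auto
    qed
    then show "(\<Union>i. B i) \<in> ?I" using B by auto
  qed
  then have "sigma_sets (space M) ?I = ?I"
    by (rule sigma_algebra.sigma_sets_eq)
  moreover have "sets (inv_algebra M S (carrier G)) = sigma_sets (space M) ?I"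
    unfolding inv_algebra_def gen by (rule sets_measure_of) (use sets.sets_into_space in auto)
  ultimately show ?thesis by auto
qed

lemma space_inv_algebra: "space (inv_algebra M S H) = space M"
  unfolding inv_algebra_def by (rule space_measure_of) (use sets.sets_into_space in auto)

lemma subalgebra_inv_algebra: "subalgebra M (inv_algebra M S (carrier G))"
  by (auto simp: subalgebra_def space_inv_algebra sets_inv_algebra_iff)

lemma measurable_inv_algebraI:
  fixes f :: "'a \<Rightarrow> 'c::topological_space"
  assumes f: "f \<in> borel_measurable M"
    and inv: "\<And>g. g \<in> carrier G \<Longrightarrow> AE x in M. f (S g x) = f x"
  shows "f \<in> borel_measurable (inv_algebra M S (carrier G))"
proof (rule measurableI)
  fix B :: "'c set" assume "B \<in> sets borel"
  then have "f -` B \<inter> space M \<in> sets M" using f by (rule measurable_sets[rotated])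
  moreover have "AE x in M. S g x \<in> f -` B \<inter> space M \<longleftrightarrow> x \<in> f -` B \<inter> space M" if "g \<in> carrier G" for g
    using inv[OF that] AE_space by eventually_elim (use that in \<open>auto simp: act_space\<close>)
  ultimately show "f -` B \<inter> space (inv_algebra M S (carrier G)) \<in> sets (inv_algebra M S (carrier G))"
    by (simp add: space_inv_algebra sets_inv_algebra_iff)
qed simp

text \<open>The indicator of an almost invariant set may be evaluated at \<open>S g x\<close>
  instead of \<open>x\<close>; the whole integrand is then a composite with a measure-preserving
  map.\<close>

lemma set_integral_act:
  fixes f :: "'a \<Rightarrow> 'c::{banach, second_countable_topology}"
  assumes B: "B \<in> sets (inv_algebra M S (carrier G))" and g: "g \<in> carrier G" and f: "f \<in> borel_measurable M"
  shows "(\<integral>x\<in>B. f (S g x) \<partial>M) = (\<integral>x\<in>B. f x \<partial>M)"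
proof -
  have BM[measurable]: "B \<in> sets M" and inv: "AE x in M. S g x \<in> B \<longleftrightarrow> x \<in> B"
    using B g by (auto simp: sets_inv_algebra_iff)
  note [measurable] = act_measurable[OF g] f
  have "(\<integral>x\<in>B. f (S g x) \<partial>M) = (\<integral>x. indicator B (S g x) *\<^sub>R f (S g x) \<partial>M)"
    unfolding set_lebesgue_integral_def
  proof (rule integral_cong_AE)
    show "AE x in M. indicat_real B x *\<^sub>R f (S g x) = indicat_real B (S g x) *\<^sub>R f (S g x)"
      using inv by eventually_elim (simp add: indicator_def)
  qed measurable
  also have "\<dots> = (\<integral>x\<in>B. f x \<partial>M)"
    unfolding set_lebesgue_integral_def by (rule integral_act[OF g]) measurable
  finally show ?thesis .
qed

end

section \<open>Disintegrations\<close>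

text \<open>\<open>M \<bind> \<kappa>\<close> is the join of the distribution of the kernel, so
  \<open>integral_join\<close> settles real functions. For complex ones the real and imaginary parts
  are treated separately.\<close>

lemma integral_bind_kernel:
  fixes f :: "'b \<Rightarrow> complex"
  assumes M: "finite_measure M" "space M \<noteq> {}"
    and \<kappa>: "\<kappa> \<in> M \<rightarrow>\<^sub>M prob_algebra N" and f: "f \<in> borel_measurable N"
    and le: "\<And>x. x \<in> space N \<Longrightarrow> cmod (f x) \<le> C"
  shows "(\<integral>x. f x \<partial>(M \<bind> \<kappa>)) = (\<integral>x. \<integral>y. f y \<partial>\<kappa> x \<partial>M)"
proof -
  interpret finite_measure M by fact
  have \<kappa>'[measurable]: "\<kappa> \<in> M \<rightarrow>\<^sub>M subprob_algebra N" using \<kappa> by (rule measurable_prob_algebraD)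
  have bind: "M \<bind> \<kappa> = Giry_Monad.join (distr M (subprob_algebra N) \<kappa>)"
    using \<kappa>' M(2) by (rule bind_nonempty'')
  have sub: "subprob_space M'" if "M' \<in> space (subprob_algebra N)" for M'
    using that by (simp add: space_subprob_algebra)
  have b: "AE M' in distr M (subprob_algebra N) \<kappa>. emeasure M' (space M') \<le> ennreal 1"
    by (rule AE_I2) (auto dest!: sub subprob_space.emeasure_space_le_1)
  have fin: "finite_measure (distr M (subprob_algebra N) \<kappa>)"
    by (rule finite_measure_distr) simp
  have real: "integrable (M \<bind> \<kappa>) u \<and> (\<integral>x. u x \<partial>(M \<bind> \<kappa>)) = (\<integral>x. \<integral>y. u y \<partial>\<kappa> x \<partial>M)"
    if u[measurable]: "u \<in> borel_measurable N" and le: "\<And>x. x \<in> space N \<Longrightarrow> \<bar>u x\<bar> \<le> C" for u :: "'b \<Rightarrow> real"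
    unfolding bind using integrable_join[OF u le _ fin b] integral_join[OF u le _ fin b]
    by (simp add: integral_distr)
  have \<kappa>x: "prob_space (\<kappa> x)" "sets (\<kappa> x) = sets N" if "x \<in> space M" for x
    using measurable_space[OF \<kappa> that] by (auto simp: space_prob_algebra)
  have ix: "integrable (\<kappa> x) f" if "x \<in> space M" for x
  proof -
    interpret prob_space "\<kappa> x" using \<kappa>x[OF that] by simp
    show ?thesis
      using f le \<kappa>x(2)[OF that] sets_eq_imp_space_eq[OF \<kappa>x(2)[OF that]]
      by (intro integrable_const_bound[where B=C]) (auto cong: measurable_cong_sets)
  qed
  have m[measurable]: "(\<lambda>x. \<integral>y. f y \<partial>\<kappa> x) \<in> borel_measurable M"
    using measurable_compose[OF \<kappa>' integral_measurable_subprob_algebra[OF f]] .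
  have le': "cmod (\<integral>y. f y \<partial>\<kappa> x) \<le> C" if "x \<in> space M" for x
  proof -
    interpret prob_space "\<kappa> x" using \<kappa>x[OF that] by simp
    have "cmod (\<integral>y. f y \<partial>\<kappa> x) \<le> (\<integral>y. cmod (f y) \<partial>\<kappa> x)" by simp
    also have "\<dots> \<le> C"
      using ix[OF that] le sets_eq_imp_space_eq[OF \<kappa>x(2)[OF that]]
      by (intro integral_le_const) auto
    finally show ?thesis .
  qed
  have iM: "integrable M (\<lambda>x. \<integral>y. f y \<partial>\<kappa> x)"
    by (rule integrable_const_bound[where B=C]) (auto simp: le')
  have re: "(\<lambda>x. Re (f x)) \<in> borel_measurable N" "\<And>x. x \<in> space N \<Longrightarrow> \<bar>Re (f x)\<bar> \<le> C"
    and im: "(\<lambda>x. Im (f x)) \<in> borel_measurable N" "\<And>x. x \<in> space N \<Longrightarrow> \<bar>Im (f x)\<bar> \<le> C"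
    using f le order_trans[OF abs_Re_le_cmod] order_trans[OF abs_Im_le_cmod] by auto
  \<comment> \<open>Integrability is needed to move real and imaginary parts through the
    integral.\<close>
  have ib: "integrable (M \<bind> \<kappa>) f"
  proof -
    have "integrable (M \<bind> \<kappa>) (\<lambda>x. complex_of_real (Re (f x)) + \<i> * complex_of_real (Im (f x)))"
      using real[OF re] real[OF im]
      by (intro Bochner_Integration.integrable_add integrable_mult_right integrable_of_real) auto
    then show ?thesis by (simp add: complex_eq[symmetric])
  qed
  show ?thesis
  proof (rule complex_eqI)
    have "Re (\<integral>x. f x \<partial>(M \<bind> \<kappa>)) = (\<integral>x. \<integral>y. Re (f y) \<partial>\<kappa> x \<partial>M)"
      using real[OF re] ib by simp
    also have "\<dots> = (\<integral>x. Re (\<integral>y. f y \<partial>\<kappa> x) \<partial>M)"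
      by (intro Bochner_Integration.integral_cong refl) (use ix in simp)
    finally show "Re (\<integral>x. f x \<partial>(M \<bind> \<kappa>)) = Re (\<integral>x. \<integral>y. f y \<partial>\<kappa> x \<partial>M)"
      using iM by simp
    have "Im (\<integral>x. f x \<partial>(M \<bind> \<kappa>)) = (\<integral>x. \<integral>y. Im (f y) \<partial>\<kappa> x \<partial>M)"
      using real[OF im] ib by simp
    also have "\<dots> = (\<integral>x. Im (\<integral>y. f y \<partial>\<kappa> x) \<partial>M)"
      by (intro Bochner_Integration.integral_cong refl) (use ix in simp)
    finally show "Im (\<integral>x. f x \<partial>(M \<bind> \<kappa>)) = Im (\<integral>x. \<integral>y. f y \<partial>\<kappa> x \<partial>M)"
      using iM by simp
  qed
qed

locale disintegrated = prob_space M for M :: "'a measure" +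
  fixes \<Phi> :: "'a measure" and \<kappa> :: "'a \<Rightarrow> 'a measure"
  assumes sub: "subalgebra M \<Phi>" and dis: "disintegration M \<Phi> \<kappa>"
begin

lemma kernel: "\<kappa> \<in> M \<rightarrow>\<^sub>M prob_algebra M"
  using dis by (intro measurable_from_subalg[OF sub]) (simp add: disintegration_def)

lemma kernel_subprob: "\<kappa> \<in> M \<rightarrow>\<^sub>M subprob_algebra M"
  using kernel by (rule measurable_prob_algebraD)

lemma kernel_prob: "x \<in> space M \<Longrightarrow> prob_space (\<kappa> x)"
  and kernel_sets: "x \<in> space M \<Longrightarrow> sets (\<kappa> x) = sets M"
  using measurable_space[OF kernel] by (auto simp: space_prob_algebra)

lemma kernel_space: "x \<in> space M \<Longrightarrow> space (\<kappa> x) = space M"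
  by (rule sets_eq_imp_space_eq[OF kernel_sets])

lemma kernel_unit: "f \<in> unit_meas M \<Longrightarrow> x \<in> space M \<Longrightarrow> f \<in> unit_meas (\<kappa> x)"
  by (auto simp: unit_meas_def cong: measurable_cong_sets dest: kernel_sets)

lemma kernel_integrable: "f \<in> unit_meas M \<Longrightarrow> x \<in> space M \<Longrightarrow> integrable (\<kappa> x) f"
  using finite_measure.unit_meas_integrable[OF prob_space.finite_measure[OF kernel_prob] kernel_unit] by blast

lemma kernel_integral_measurable:
  assumes "f \<in> unit_meas M"
  shows "(\<lambda>x. \<integral>y. f y \<partial>\<kappa> x) \<in> borel_measurable \<Phi>"
proof -
  have "\<kappa> \<in> \<Phi> \<rightarrow>\<^sub>M subprob_algebra M"
    using dis by (auto simp: disintegration_def intro: measurable_prob_algebraD)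
  then show ?thesis
    using measurable_compose[OF _ integral_measurable_subprob_algebra[OF unit_meas_measurable[OF assms]]] by blast
qed

lemma kernel_integral_le:
  assumes "f \<in> unit_meas M" "x \<in> space M"
  shows "cmod (\<integral>y. f y \<partial>\<kappa> x) \<le> 1"
proof -
  interpret K: prob_space "\<kappa> x" using kernel_prob assms by simp
  have "cmod (\<integral>y. f y \<partial>\<kappa> x) \<le> (\<integral>y. cmod (f y) \<partial>\<kappa> x)" by simp
  also have "\<dots> \<le> 1"
    using kernel_integrable[OF assms] unit_meas_le[OF assms(1)] by (intro K.integral_le_const) auto
  finally show ?thesis .
qed

text \<open>The disintegration identity says that the kernel maps the restriction of
  \<open>M\<close> to \<open>C\<close> to itself. Integrating \<open>f\<close> against this equality
  of measures gives the claim.\<close>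

lemma set_integral_kernel:
  assumes f: "f \<in> unit_meas M" and C: "C \<in> sets \<Phi>"
  shows "(\<integral>x\<in>C. (\<integral>y. f y \<partial>\<kappa> x) \<partial>M) = (\<integral>x\<in>C. f x \<partial>M)"
proof -
  have CM[measurable]: "C \<in> sets M" using C sub by (auto simp: subalgebra_def)
  \<comment> \<open>Restricting by a density keeps the space and the measurable sets of
    \<open>M\<close>, so \<open>\<kappa>\<close> remains a kernel on it.\<close>
  let ?D = "density M (\<lambda>x. ennreal (indicat_real C x))"
  have ne: "space ?D \<noteq> {}" using not_empty by simp
  have fin: "finite_measure ?D"
    by (rule finite_measureI) (simp add: emeasure_density ennreal_indicator)
  have kD: "\<kappa> \<in> ?D \<rightarrow>\<^sub>M prob_algebra M"
    using kernel by (simp cong: measurable_cong_sets)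
  have kD': "\<kappa> \<in> ?D \<rightarrow>\<^sub>M subprob_algebra M"
    using kD by (rule measurable_prob_algebraD)
  have eq: "?D \<bind> \<kappa> = ?D"
  proof (rule measure_eqI)
    show s: "sets (?D \<bind> \<kappa>) = sets ?D"
      using sets_bind[OF sets_kernel[OF kD'] ne] by simp
    fix B assume "B \<in> sets (?D \<bind> \<kappa>)"
    then have B[measurable]: "B \<in> sets M" using s by simp
    have [measurable]: "(\<lambda>x. emeasure (\<kappa> x) B) \<in> borel_measurable M"
      using measurable_emeasure_kernel[OF kernel_subprob B] .
    have "emeasure (?D \<bind> \<kappa>) B = (\<integral>\<^sup>+x. emeasure (\<kappa> x) B \<partial>?D)"
      by (rule emeasure_bind[OF ne kD' B])
    also have "\<dots> = (\<integral>\<^sup>+x\<in>C. emeasure (\<kappa> x) B \<partial>M)"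
      by (subst nn_integral_density) (auto simp: mult.commute ennreal_indicator)
    also have "\<dots> = emeasure M (B \<inter> C)"
      using dis B C by (simp add: disintegration_def)
    also have "\<dots> = emeasure ?D B"
      by (simp add: emeasure_density ennreal_indicator Int_commute flip: indicator_inter_arith)
    finally show "emeasure (?D \<bind> \<kappa>) B = emeasure ?D B" .
  qed
  have "(\<integral>x\<in>C. f x \<partial>M) = (\<integral>x. f x \<partial>?D)"
    unfolding set_lebesgue_integral_def
    using unit_meas_measurable[OF f] by (subst integral_density) auto
  also have "\<dots> = (\<integral>x. f x \<partial>(?D \<bind> \<kappa>))" unfolding eq ..
  also have "\<dots> = (\<integral>x. \<integral>y. f y \<partial>\<kappa> x \<partial>?D)"
    using unit_measD[OF f] by (intro integral_bind_kernel[OF fin ne kD]) auto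
  also have "\<dots> = (\<integral>x\<in>C. (\<integral>y. f y \<partial>\<kappa> x) \<partial>M)"
    unfolding set_lebesgue_integral_def
    using measurable_from_subalg[OF sub kernel_integral_measurable[OF f]]
    by (subst integral_density) auto
  finally show ?thesis ..
qed

text \<open>Both sides are versions of the conditional expectation of \<open>f\<close> given
  \<open>\<Phi>\<close>. Uniqueness is applied to the real and imaginary parts of \<open>p\<close>,
  which are their own conditional expectations.\<close>

lemma AE_eq_kernel_integral:
  assumes f: "f \<in> unit_meas M" and p: "p \<in> borel_measurable \<Phi>" and le: "AE x in M. cmod (p x) \<le> 1"
    and eq: "\<And>C. C \<in> sets \<Phi> \<Longrightarrow> (\<integral>x\<in>C. p x \<partial>M) = (\<integral>x\<in>C. f x \<partial>M)"
  shows "AE x in M. p x = (\<integral>y. f y \<partial>\<kappa> x)"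
proof -
  interpret finite_measure_subalgebra M \<Phi> by unfold_locales (rule sub)
  let ?q = "\<lambda>x. \<integral>y. f y \<partial>\<kappa> x"
  have q: "?q \<in> borel_measurable \<Phi>" by (rule kernel_integral_measurable[OF f])
  note [measurable] = q p and [measurable] = measurable_from_subalg[OF sub q] measurable_from_subalg[OF sub p]
  have ip: "integrable M p" and iq: "integrable M ?q"
    using le kernel_integral_le[OF f] by (auto intro!: integrable_const_bound[where B=1])
  have pq: "(\<integral>x\<in>C. p x \<partial>M) = (\<integral>x\<in>C. ?q x \<partial>M)" if "C \<in> sets \<Phi>" for C
    using eq[OF that] set_integral_kernel[OF f that] by simp
  have ipC: "integrable M (\<lambda>x. indicator C x *\<^sub>R p x)" and iqC: "integrable M (\<lambda>x. indicator C x *\<^sub>R ?q x)"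
    if "C \<in> sets \<Phi>" for C
    using that sub ip iq by (auto intro!: integrable_mult_indicator simp: subalgebra_def)
  have "(\<integral>x\<in>C. Re (p x) \<partial>M) = (\<integral>x\<in>C. Re (?q x) \<partial>M)" if "C \<in> sets \<Phi>" for C
    using arg_cong[OF pq[OF that], of Re] ipC[OF that] iqC[OF that]
    by (simp add: set_lebesgue_integral_def flip: integral_Re)
  then have re: "AE x in M. real_cond_exp M \<Phi> (\<lambda>x. Re (p x)) x = Re (?q x)"
    using ip iq by (intro real_cond_exp_charact) auto
  have "(\<integral>x\<in>C. Im (p x) \<partial>M) = (\<integral>x\<in>C. Im (?q x) \<partial>M)" if "C \<in> sets \<Phi>" for C
    using arg_cong[OF pq[OF that], of Im] ipC[OF that] iqC[OF that]
    by (simp add: set_lebesgue_integral_def flip: integral_Im)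
  then have im: "AE x in M. real_cond_exp M \<Phi> (\<lambda>x. Im (p x)) x = Im (?q x)"
    using ip iq by (intro real_cond_exp_charact) auto
  have "AE x in M. real_cond_exp M \<Phi> (\<lambda>x. Re (p x)) x = Re (p x)"
    "AE x in M. real_cond_exp M \<Phi> (\<lambda>x. Im (p x)) x = Im (p x)"
    using ip by (intro real_cond_exp_F_meas; simp)+
  with re im show ?thesis
    by eventually_elim (simp add: complex_eq_iff)
qed

lemma pair_kernel: "(\<lambda>x. \<kappa> x \<Otimes>\<^sub>M \<kappa> x) \<in> M \<rightarrow>\<^sub>M prob_algebra (M \<Otimes>\<^sub>M M)"
  using kernel by (intro measurable_pair_prob)

lemma sets_rel_square: "sets (rel_square M \<kappa>) = sets (M \<Otimes>\<^sub>M M)"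
  unfolding rel_square_def
  by (rule sets_bind'[OF _ pair_kernel]) (simp add: space_prob_algebra prob_space_axioms)

lemma emeasure_kernel: 
  assumes "B \<in> sets M" shows "(\<integral>\<^sup>+x. emeasure (\<kappa> x) B \<partial>M) = emeasure M B"
proof -
  have "space M \<in> sets \<Phi>" using sub sets.top[of \<Phi>] by (simp add: subalgebra_def)
  then have "(\<integral>\<^sup>+x\<in>space M. emeasure (\<kappa> x) B \<partial>M) = emeasure M (B \<inter> space M)"
    using dis assms unfolding disintegration_def by blast
  moreover have "B \<inter> space M = B" using sets.sets_into_space[OF assms] by auto
  moreover have "(\<integral>\<^sup>+x\<in>space M. emeasure (\<kappa> x) B \<partial>M) = (\<integral>\<^sup>+x. emeasure (\<kappa> x) B \<partial>M)"
    by (rule nn_integral_cong) simp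
  ultimately show ?thesis
    by simp
qed

text \<open>Both marginals of the product of \<open>\<kappa> x\<close> with itself are
  \<open>\<kappa> x\<close>, and these average to \<open>M\<close>.\<close>

lemma distr_rel_square:
  shows "distr (rel_square M \<kappa>) M fst = M" (is ?fst)
    and "distr (rel_square M \<kappa>) M snd = M" (is ?snd)
proof -
  have e: "emeasure (rel_square M \<kappa>) B = (\<integral>\<^sup>+x. emeasure (\<kappa> x \<Otimes>\<^sub>M \<kappa> x) B \<partial>M)"
    if "B \<in> sets (M \<Otimes>\<^sub>M M)" for B
    unfolding rel_square_def using not_empty that
    by (intro emeasure_bind[OF _ measurable_prob_algebraD[OF pair_kernel]])
  have sp: "space (rel_square M \<kappa>) = space M \<times> space M"
    using sets_eq_imp_space_eq[OF sets_rel_square] by (simp add: space_pair_measure)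
  have m: "fst \<in> rel_square M \<kappa> \<rightarrow>\<^sub>M M" "snd \<in> rel_square M \<kappa> \<rightarrow>\<^sub>M M"
    using measurable_cong_sets[OF sets_rel_square refl] by auto
  have t: "emeasure (\<kappa> x \<Otimes>\<^sub>M \<kappa> x) (B \<times> space M) = emeasure (\<kappa> x) B \<and>
    emeasure (\<kappa> x \<Otimes>\<^sub>M \<kappa> x) (space M \<times> B) = emeasure (\<kappa> x) B"
    if "x \<in> space M" "B \<in> sets M" for x B
  proof -
    interpret K: prob_space "\<kappa> x" using kernel_prob that by simp
    show ?thesis
      using that kernel_sets[OF that(1)] kernel_space[OF that(1)] K.emeasure_space_1
      by (simp add: K.emeasure_pair_measure_Times)
  qed
  show ?fst
  proof (rule measure_eqI)
    fix B assume "B \<in> sets (distr (rel_square M \<kappa>) M fst)"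
    then have B: "B \<in> sets M" by simp
    have "fst -` B \<inter> space (rel_square M \<kappa>) = B \<times> space M"
      using sets.sets_into_space[OF B] by (auto simp: sp)
    then have "emeasure (distr (rel_square M \<kappa>) M fst) B = (\<integral>\<^sup>+x. emeasure (\<kappa> x \<Otimes>\<^sub>M \<kappa> x) (B \<times> space M) \<partial>M)"
      using m B by (simp add: emeasure_distr e)
    also have "\<dots> = emeasure M B"
      using t B by (simp add: emeasure_kernel[symmetric] cong: nn_integral_cong)
    finally show "emeasure (distr (rel_square M \<kappa>) M fst) B = emeasure M B" .
  qed simp
  show ?snd
  proof (rule measure_eqI)
    fix B assume "B \<in> sets (distr (rel_square M \<kappa>) M snd)"
    then have B: "B \<in> sets M" by simp
    have "snd -` B \<inter> space (rel_square M \<kappa>) = space M \<times> B"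
      using sets.sets_into_space[OF B] by (auto simp: sp)
    then have "emeasure (distr (rel_square M \<kappa>) M snd) B = (\<integral>\<^sup>+x. emeasure (\<kappa> x \<Otimes>\<^sub>M \<kappa> x) (space M \<times> B) \<partial>M)"
      using m B by (simp add: emeasure_distr e)
    also have "\<dots> = emeasure M B"
      using t B by (simp add: emeasure_kernel[symmetric] cong: nn_integral_cong)
    finally show "emeasure (distr (rel_square M \<kappa>) M snd) B = emeasure M B" .
  qed simp
qed

text \<open>Fubini on each fibre factors the integral into
  \<open>\<integral>y. f y \<partial>\<kappa> x\<close> and its conjugate. The result is the squared
  norm of the conditional expectation, the form in which the mean ergodic limit appears.\<close>

lemma integral_rel_square:
  assumes f: "f \<in> unit_meas M"
  shows "(\<integral>z. f (fst z) * cnj (f (snd z)) \<partial>rel_square M \<kappa>) = of_real (\<integral>x. (cmod (\<integral>y. f y \<partial>\<kappa> x))\<^sup>2 \<partial>M)"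
proof -
  let ?h = "\<lambda>z. f (fst z) * cnj (f (snd z))"
  have h: "?h \<in> unit_meas (M \<Otimes>\<^sub>M M)"
    by (intro unit_meas_mult unit_meas_cnj unit_meas_comp[OF f]) auto
  have "(\<integral>z. ?h z \<partial>rel_square M \<kappa>) = (\<integral>x. \<integral>z. ?h z \<partial>(\<kappa> x \<Otimes>\<^sub>M \<kappa> x) \<partial>M)"
    unfolding rel_square_def
    by (rule integral_bind_kernel[OF finite_measure_axioms not_empty pair_kernel unit_meas_measurable[OF h] unit_meas_le[OF h]])
  also have "\<dots> = (\<integral>x. of_real ((cmod (\<integral>y. f y \<partial>\<kappa> x))\<^sup>2) \<partial>M)"
  proof (rule Bochner_Integration.integral_cong[OF refl])
    fix x assume x: "x \<in> space M"
    interpret K: prob_space "\<kappa> x" using kernel_prob x by simp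
    interpret KK: pair_prob_space "\<kappa> x" "\<kappa> x" ..
    have f': "f \<in> unit_meas (\<kappa> x)" using kernel_unit[OF f x] .
    have h': "?h \<in> unit_meas (\<kappa> x \<Otimes>\<^sub>M \<kappa> x)"
      by (intro unit_meas_mult unit_meas_cnj unit_meas_comp[OF f']) auto
    have "(\<integral>z. ?h z \<partial>(\<kappa> x \<Otimes>\<^sub>M \<kappa> x)) = (\<integral>a. \<integral>b. f a * cnj (f b) \<partial>\<kappa> x \<partial>\<kappa> x)"
      using KK.integral_fst'[OF KK.unit_meas_integrable[OF h']] by simp
    also have "\<dots> = (\<integral>y. f y \<partial>\<kappa> x) * cnj (\<integral>y. f y \<partial>\<kappa> x)"
      by simp
    finally show "(\<integral>z. ?h z \<partial>(\<kappa> x \<Otimes>\<^sub>M \<kappa> x)) = of_real ((cmod (\<integral>y. f y \<partial>\<kappa> x))\<^sup>2)"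
      by (simp only: complex_norm_square)
  qed
  also have "\<dots> = of_real (\<integral>x. (cmod (\<integral>y. f y \<partial>\<kappa> x))\<^sup>2 \<partial>M)"
    by (rule integral_complex_of_real)
  finally show ?thesis .
qed

end

section \<open>The limit as a conditional expectation\<close>

context Folner_pmp_action
begin

lemma A_unit: "A n f \<in> unit_meas M"
  by (rule orbit_mean_unit[OF f_unit F_carrier])

lemma A_measurable[measurable]: "A n f \<in> borel_measurable M"
  by (rule unit_meas_measurable[OF A_unit])

text \<open>The Cauchy criterion for the right-hand side of \<open>sq_diff_le\<close>: two excesses
  over \<open>inf_sq\<close> below \<open>e / 4\<close>, each counted twice, add up to less than
  \<open>e\<close>.\<close>

lemma sq_diff_tendsto:
  assumes "e > 0"
  shows "\<exists>N. \<forall>m\<ge>N. \<forall>n\<ge>N. 2 * sq (A m f) + 2 * sq (A n f) - 4 * inf_sq < e"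
proof -
  have "\<forall>\<^sub>F n in sequentially. sq (A n f) < inf_sq + e / 4"
    using assms by (intro order_tendstoD(2)[OF sq_avg_tendsto]) simp
  then obtain N where "\<And>n. n \<ge> N \<Longrightarrow> sq (A n f) < inf_sq + e / 4"
    by (auto simp: eventually_sequentially)
  then have "2 * sq (A m f) + 2 * sq (A n f) - 4 * inf_sq < e" if "m \<ge> N" "n \<ge> N" for m n
    using that(1)[THEN \<open>\<And>n. n \<ge> N \<Longrightarrow> sq (A n f) < inf_sq + e / 4\<close>]
      that(2)[THEN \<open>\<And>n. n \<ge> N \<Longrightarrow> sq (A n f) < inf_sq + e / 4\<close>] by linarith
  then show ?thesis by blast
qed

text \<open>The parallelogram estimate is transferred to the L1 norm, for which almost everywhere
  convergent subsequences are extracted.\<close>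

lemma L1_diff_square_le:
  assumes "same_mean B" "same_mean C"
  shows "(\<integral>x. cmod (B x - C x) \<partial>M)\<^sup>2 \<le> 2 * sq B + 2 * sq C - 4 * inf_sq"
proof -
  have u: "B \<in> unit_meas M" "C \<in> unit_meas M"
    using assms by (auto simp: same_mean_def)
  note [measurable] = u[THEN unit_meas_measurable]
  have "integrable M (\<lambda>x. (cmod (B x - C x))\<^sup>2)"
  \<comment> \<open>Values in the unit disc differ by at most 2.\<close>
  proof (rule integrable_const_bound[where B = 4])
    have "cmod (B x - C x) \<le> 2" for x
      using norm_triangle_ineq4[of "B x" "C x"] unit_meas_le[OF u(1), of x] unit_meas_le[OF u(2), of x] by linarith
    then show "AE x in M. norm ((cmod (B x - C x))\<^sup>2) \<le> 4"
      using power_mono[of _ "2::real" 2] by (intro AE_I2) fastforce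
  qed measurable
  then show ?thesis
    using L1_square_le[of "\<lambda>x. B x - C x"] sq_diff_le[OF assms] by (simp add: sq_def)
qed

text \<open>Near minimality makes the averages Cauchy in L1, and an L1-Cauchy sequence has an almost
  everywhere convergent subsequence.\<close>

lemma subsequence_limit:
  obtains r p where "strict_mono r" "p \<in> borel_measurable M" "AE x in M. (\<lambda>k. A (r k) f x) \<longlonglongrightarrow> p x"
proof -
  have "\<exists>N. \<forall>i\<ge>N. \<forall>j\<ge>N. (\<integral>x. norm (A i f x - A j f x) \<partial>M) < e" if "e > 0" for e
  proof -
    obtain N where N: "\<And>m n. m \<ge> N \<Longrightarrow> n \<ge> N \<Longrightarrow> 2 * sq (A m f) + 2 * sq (A n f) - 4 * inf_sq < e\<^sup>2"
      using sq_diff_tendsto[of "e\<^sup>2"] \<open>e > 0\<close> by auto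
    have "(\<integral>x. norm (A i f x - A j f x) \<partial>M) < e" if "i \<ge> N" "j \<ge> N" for i j
      using L1_diff_square_le[OF same_mean_avg same_mean_avg, of i j] N[OF that] \<open>e > 0\<close>
      by - (rule power_less_imp_less_base[of _ 2 e], auto)
    then show ?thesis by blast
  qed
  then obtain r where r: "strict_mono r" "AE x in M. Cauchy (\<lambda>k. A (r k) f x)"
    using cauchy_L1_AE_cauchy_subseq[of M "\<lambda>n. A n f"] unit_meas_integrable[OF A_unit] by blast
  have "AE x in M. (\<lambda>k. A (r k) f x) \<longlonglongrightarrow> lim (\<lambda>k. A (r k) f x)"
    using r(2) by eventually_elim (blast intro: Cauchy_convergent convergent_LIMSEQ_iff[THEN iffD1])
  then show ?thesis
    using r(1) by (intro that[of r "\<lambda>x. lim (\<lambda>k. A (r k) f x)"]) measurable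
qed

text \<open>The squared norms converge to \<open>inf_sq\<close> along the full sequence, so the
  limit \<open>p\<close> of one subsequence suffices to identify it. This \<open>p\<close> is almost
  invariant and has the integrals of \<open>f\<close> over almost invariant sets, hence it is the
  conditional expectation.\<close>

lemma mean_ergodic:
  assumes dis: "disintegration M (inv_algebra M S (carrier G)) \<kappa>"
  shows "(\<lambda>n. sq (A n f)) \<longlonglongrightarrow> (\<integral>x. (cmod (\<integral>y. f y \<partial>\<kappa> x))\<^sup>2 \<partial>M)"
proof -
  let ?\<Phi> = "inv_algebra M S (carrier G)"
  interpret disintegrated M ?\<Phi> \<kappa>
    by unfold_locales (rule subalgebra_inv_algebra, rule dis)
  obtain r p where r: "strict_mono r" and p[measurable]: "p \<in> borel_measurable M"
    and lim: "AE x in M. (\<lambda>k. A (r k) f x) \<longlonglongrightarrow> p x"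
    by (rule subsequence_limit)
  have A_le: "cmod (A n f x) \<le> 1" for n x
    by (rule unit_meas_le[OF A_unit])
  have p_le: "AE x in M. cmod (p x) \<le> 1"
    using lim by eventually_elim (auto intro: LIMSEQ_le_const2[OF tendsto_norm] simp: A_le)
  \<comment> \<open>Dominated convergence shows that \<open>p\<close> attains the infimum.\<close>
  have "(\<lambda>k. sq (A (r k) f)) \<longlonglongrightarrow> sq p"
    unfolding sq_def
  proof (rule integral_dominated_convergence[where w = "\<lambda>_. 1"])
    show "AE x in M. (\<lambda>k. (cmod (A (r k) f x))\<^sup>2) \<longlonglongrightarrow> (cmod (p x))\<^sup>2"
      using lim by eventually_elim (intro tendsto_intros)
  qed (auto simp: A_le power_le_one)
  moreover have "(\<lambda>k. sq (A (r k) f)) \<longlonglongrightarrow> inf_sq"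
    using LIMSEQ_subseq_LIMSEQ[OF sq_avg_tendsto r] by (simp add: o_def)
  ultimately have sq_p: "sq p = inf_sq"
    by (rule LIMSEQ_unique)
  have inv: "AE x in M. p (S g x) = p x" if g: "g \<in> carrier G" for g
  proof -
    note [measurable] = act_measurable[OF g]
    have lim_g: "AE x in M. (\<lambda>k. A (r k) f (S g x)) \<longlonglongrightarrow> p (S g x)"
    proof -
      have "AE x in distr M M (S g). (\<lambda>k. A (r k) f x) \<longlonglongrightarrow> p x"
        unfolding act_distr[OF g] by (rule lim)
      then show ?thesis by (rule AE_distrD[rotated]) measurable
    qed
    \<comment> \<open>The L1 distance of an average from its translate has two limits: the distance
      of \<open>p\<close> from its translate, by dominated convergence, and 0, by near
      minimality.\<close>
    have "(\<lambda>k. \<integral>x. cmod (A (r k) f (S g x) - A (r k) f x) \<partial>M) \<longlonglongrightarrow> (\<integral>x. cmod (p (S g x) - p x) \<partial>M)"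
    proof (rule integral_dominated_convergence[where w = "\<lambda>_. 2"])
      show "AE x in M. (\<lambda>k. cmod (A (r k) f (S g x) - A (r k) f x)) \<longlonglongrightarrow> cmod (p (S g x) - p x)"
        using lim lim_g by eventually_elim (intro tendsto_intros)
      have "cmod (A (r k) f (S g x) - A (r k) f x) \<le> 2" for k x
        using norm_triangle_ineq4[of "A (r k) f (S g x)" "A (r k) f x"] A_le[of "r k" x] A_le[of "r k" "S g x"] by linarith
      then show "AE x in M. norm (cmod (A (r k) f (S g x) - A (r k) f x)) \<le> 2" for k
        by auto
    qed auto
    moreover have "(\<lambda>k. \<integral>x. cmod (A (r k) f (S g x) - A (r k) f x) \<partial>M) \<longlonglongrightarrow> 0"
    proof (rule Lim_null_comparison)
      \<comment> \<open>Translation preserves the squared norm, so the bound of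
        \<open>L1_diff_square_le\<close> collapses to four times the excess over
        \<open>inf_sq\<close>.\<close>
      have "(\<integral>x. cmod (A (r k) f (S g x) - A (r k) f x) \<partial>M)\<^sup>2 \<le> 4 * (sq (A (r k) f) - inf_sq)" for k
        using L1_diff_square_le[OF same_mean_avg_shift[OF g] same_mean_avg, of "r k" "r k"]
          integral_act[OF g, of "\<lambda>x. (cmod (A (r k) f x))\<^sup>2"]
        by (simp add: sq_def)
      then show "\<forall>\<^sub>F k in sequentially. norm (\<integral>x. cmod (A (r k) f (S g x) - A (r k) f x) \<partial>M) \<le> sqrt (4 * (sq (A (r k) f) - inf_sq))"
        by (auto intro!: always_eventually real_le_rsqrt)
      have "(\<lambda>k. sqrt (4 * (sq (A (r k) f) - inf_sq))) \<longlonglongrightarrow> sqrt (4 * (inf_sq - inf_sq))"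
        by (intro tendsto_intros) fact
      then show "(\<lambda>k. sqrt (4 * (sq (A (r k) f) - inf_sq))) \<longlonglongrightarrow> 0" by simp
    qed
    ultimately have "(\<integral>x. cmod (p (S g x) - p x) \<partial>M) = 0"
      by (rule LIMSEQ_unique)
    moreover have "integrable M (\<lambda>x. cmod (p (S g x) - p x))"
    proof (rule integrable_const_bound[where B = 2])
      have "AE x in distr M M (S g). cmod (p x) \<le> 1"
        unfolding act_distr[OF g] by (rule p_le)
      then have "AE x in M. cmod (p (S g x)) \<le> 1"
        by (rule AE_distrD[rotated]) measurable
      with p_le show "AE x in M. norm (cmod (p (S g x) - p x)) \<le> 2"
        by eventually_elim (use norm_triangle_ineq4 in \<open>fastforce intro: order_trans\<close>)
    qed measurable
    ultimately show ?thesis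
      by (subst (asm) integral_nonneg_eq_0_iff_AE) auto
  qed
  have "AE x in M. p x = (\<integral>y. f y \<partial>\<kappa> x)"
  proof (rule AE_eq_kernel_integral[OF f_unit measurable_inv_algebraI[OF p inv] p_le])
    fix C assume C: "C \<in> sets ?\<Phi>"
    then have [measurable]: "C \<in> sets M" by (simp add: sets_inv_algebra_iff)
    \<comment> \<open>Every average has the same integral as \<open>f\<close> over \<open>C\<close>,
      so the limit does too.\<close>
    have "(\<integral>x\<in>C. A n f x \<partial>M) = (\<integral>x\<in>C. f x \<partial>M)" for n
    proof -
      have i: "integrable M (\<lambda>x. indicator C x *\<^sub>R f (S g x))" if "g \<in> F n" for g
        using that F_in by (intro integrable_mult_indicator unit_meas_integrable unit_meas_comp[OF f_unit]) auto
      have "(\<integral>x\<in>C. A n f x \<partial>M) = (\<integral>x. mean (F n) (\<lambda>g. indicator C x *\<^sub>R f (S g x)) \<partial>M)"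
        unfolding set_lebesgue_integral_def orbit_mean_def
        by (intro Bochner_Integration.integral_cong refl)
          (simp add: mean_def scaleR_conv_of_real sum_distrib_left)
      also have "\<dots> = mean (F n) (\<lambda>g. \<integral>x\<in>C. f (S g x) \<partial>M)"
        unfolding set_lebesgue_integral_def by (rule integral_mean[OF i])
      also have "\<dots> = mean (F n) (\<lambda>g. \<integral>x\<in>C. f x \<partial>M)"
        by (intro mean_cong set_integral_act[OF C F_in] unit_meas_measurable[OF f_unit])
      finally show ?thesis by (simp add: mean_const F_finite F_nonempty)
    qed
    moreover have "(\<lambda>k. \<integral>x\<in>C. A (r k) f x \<partial>M) \<longlonglongrightarrow> (\<integral>x\<in>C. p x \<partial>M)"
      unfolding set_lebesgue_integral_def
    proof (rule integral_dominated_convergence[where w = "\<lambda>_. 1"])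
      show "AE x in M. (\<lambda>k. indicator C x *\<^sub>R A (r k) f x) \<longlonglongrightarrow> indicator C x *\<^sub>R p x"
        using lim by eventually_elim (intro tendsto_intros)
    qed (auto simp: A_le indicator_def)
    ultimately show "(\<integral>x\<in>C. p x \<partial>M) = (\<integral>x\<in>C. f x \<partial>M)"
      by (simp add: LIMSEQ_const_iff)
  qed
  then have "sq p = (\<integral>x. (cmod (\<integral>y. f y \<partial>\<kappa> x))\<^sup>2 \<partial>M)"
    unfolding sq_def
    using measurable_from_subalg[OF sub kernel_integral_measurable[OF f_unit]]
    by (intro integral_cong_AE) auto
  then show ?thesis
    using sq_avg_tendsto sq_p by simp
qed

end

section \<open>Towers\<close>

lemma pmp_action_of_space:
  assumes "group \<Gamma>" "pmp_space \<Gamma> M T"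
  shows "pmp_action \<Gamma> M T"
proof -
  interpret group \<Gamma> by fact
  interpret prob_space M using assms(2) by (simp add: pmp_space_def)
  interpret act: group_action \<Gamma> "space M" "\<lambda>g. restrict (T g) (space M)"
    using assms(2) by (simp add: pmp_space_def)
  have m: "T g \<in> M \<rightarrow>\<^sub>M M" "distr M M (T g) = M" if "g \<in> carrier \<Gamma>" for g
    using assms(2) that by (auto simp: pmp_space_def)
  show ?thesis
  proof
    fix g h x assume g: "g \<in> carrier \<Gamma>" and h: "h \<in> carrier \<Gamma>" and x: "x \<in> space M"
    show "T (g \<otimes>\<^bsub>\<Gamma>\<^esub> h) x = T g (T h x)"
      using act.composition_rule[OF x g h] x measurable_space[OF m(1)[OF h] x] by simp
  next
    fix x assume x: "x \<in> space M"
    show "T \<one>\<^bsub>\<Gamma>\<^esub> x = x"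
      using act.id_eq_one x by (metis restrict_apply)
  qed (use m in auto)
qed

text \<open>Pulling back along \<open>seg\<close> turns an action of the power into the block
  actions of \<open>G\<close>, to which the mean ergodic theorem applies.\<close>

lemma pmp_action_hom:
  assumes "pmp_action \<Gamma> M T" "group G" "\<phi> \<in> hom G \<Gamma>"
  shows "pmp_action G M (\<lambda>g. T (\<phi> g))"
proof -
  interpret pmp_action \<Gamma> M T by fact
  interpret G: group G by fact
  have \<phi>: "\<phi> g \<in> carrier \<Gamma>" if "g \<in> carrier G" for g
    using assms(3) that by (auto simp: hom_def)
  show ?thesis
  proof
    fix g h x assume "g \<in> carrier G" "h \<in> carrier G" "x \<in> space M"
    then show "T (\<phi> (g \<otimes>\<^bsub>G\<^esub> h)) x = T (\<phi> g) (T (\<phi> h) x)"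
      using assms(3) \<phi> by (simp add: hom_mult act_mult)
  next
    fix x assume "x \<in> space M"
    then show "T (\<phi> \<one>\<^bsub>G\<^esub>) x = x"
      using hom_one[OF assms(3,2) is_group] by (simp add: act_one)
  qed (use \<phi> in \<open>auto simp: act_distr\<close>)
qed

text \<open>The single group element through which a block of coordinates acts. Composites of block
  actions thereby become products in the power of \<open>G\<close>.\<close>

definition seg :: "('g, 'b) monoid_scheme \<Rightarrow> nat \<Rightarrow> nat \<Rightarrow> nat \<Rightarrow> 'g \<Rightarrow> nat \<Rightarrow> 'g" where
  "seg G d a b g = (\<lambda>k\<in>{1..d}. if a \<le> k \<and> k \<le> b then g else \<one>\<^bsub>G\<^esub>)"

context group
begin

lemma group_gpow: "group (gpow G d)"
  by simp

lemma seg_carrier: "g \<in> carrier G \<Longrightarrow> seg G d a b g \<in> carrier (gpow G d)"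
  by (auto simp: seg_def)

lemma seg_hom: "seg G d a b \<in> hom G (gpow G d)"
  by (auto simp: hom_def seg_def intro!: ext)

text \<open>Peeling off coordinate \<open>a\<close> prepares the change of variables that shortens
  the average by one function.\<close>

lemma seg_split:
  assumes "a \<le> i" "g \<in> carrier G"
  shows "seg G d a i g = seg G d (Suc a) i g \<otimes>\<^bsub>gpow G d\<^esub> seg G d a a g"
  using assms by (auto simp: seg_def intro!: ext)

lemma seg_empty: "seg G d (Suc a) a g = \<one>\<^bsub>gpow G d\<^esub>"
  by (auto simp: seg_def intro!: ext)

text \<open>An element of the left-hand side is constant on the coordinates above \<open>m\<close>
  and trivial below, so it is determined by coordinate \<open>d\<close>, which lies above
  \<open>m\<close>. Invariance under this subgroup is thus invariance under a block action of
  \<open>G\<close>.\<close>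

lemma L_sub_eq_range_seg:
  assumes "m < d"
  shows "L_sub G m d = seg G d (Suc m) d ` carrier G"
proof (intro equalityI subsetI)
  fix h assume h: "h \<in> L_sub G m d"
  have hc: "h \<in> carrier (gpow G d)" and h1: "\<forall>i\<in>{1..m}. h i = \<one>"
    using h unfolding L_sub_def H_sub_def by blast+
  have "h = seg G d (Suc m) d (h d)"
  proof
    fix k
    consider "k \<notin> {1..d}" | "k \<in> {1..m}" | "k \<in> {m<..d}" by fastforce
    then show "h k = seg G d (Suc m) d (h d) k"
    proof cases
      case 1
      then show ?thesis using hc by (auto simp: seg_def PiE_def extensional_def)
    next
      case 2
      then show ?thesis using h1 assms by (simp add: seg_def)
    next
      case 3
      moreover have "d \<in> {m<..d}" using assms by simp
      ultimately have "h k = h d" using h unfolding L_sub_def H_sub_def by blast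
      then show ?thesis using 3 by (simp add: seg_def)
    qed
  qed
  moreover have "h d \<in> carrier G"
    using hc assms by (auto simp: PiE_iff)
  ultimately show "h \<in> seg G d (Suc m) d ` carrier G" by blast
next
  fix h assume "h \<in> seg G d (Suc m) d ` carrier G"
  then show "h \<in> L_sub G m d"
    using assms by (auto simp: L_sub_def H_sub_def seg_def)
qed

lemma seg_in_H_sub:
  assumes "a \<le> Suc m" "g \<in> carrier G"
  shows "seg G d a d g \<in> H_sub G m d"
  using assms by (auto simp: H_sub_def seg_def)

text \<open>The indices are distinct, so each coordinate receives exactly one factor and the
  composite is the action of one element.\<close>

lemma foldr_coord_act:
  assumes "pmp_action (gpow G d) M T" and g: "\<And>i. i \<in> set is \<Longrightarrow> g i \<in> carrier G"
    and "distinct is" "set is \<subseteq> {1..d}" and x: "x \<in> space M"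
  shows "foldr (\<lambda>i \<phi>. coord_act G d T i (g i) \<circ> \<phi>) is id x =
    T (\<lambda>k\<in>{1..d}. if k \<in> set is then g k else \<one>) x"
  using g assms(3,4)
proof (induction "is")
  case Nil
  interpret pmp_action "gpow G d" M T by fact
  show ?case using act_one[OF x] by (simp add: restrict_def)
next
  case (Cons i js)
  interpret pmp_action "gpow G d" M T by fact
  let ?c = "\<lambda>k\<in>{1..d}. if k = i then g i else \<one>" and ?r = "\<lambda>k\<in>{1..d}. if k \<in> set js then g k else \<one>"
  have c: "?c \<in> carrier (gpow G d)" and r: "?r \<in> carrier (gpow G d)"
    using Cons.prems by (auto simp del: mult_product_group)
  have eq: "?c \<otimes>\<^bsub>gpow G d\<^esub> ?r = (\<lambda>k\<in>{1..d}. if k \<in> set (i # js) then g k else \<one>)"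
    using Cons.prems by (auto intro!: ext)
  have "foldr (\<lambda>i \<phi>. coord_act G d T i (g i) \<circ> \<phi>) (i # js) id x = T ?c (T ?r x)"
  proof -
    have "foldr (\<lambda>i \<phi>. coord_act G d T i (g i) \<circ> \<phi>) js id x = T ?r x"
      by (rule Cons.IH) (use Cons.prems in auto)
    then show ?thesis
      by (simp only: foldr.simps o_apply coord_act_def)
  qed
  also have "\<dots> = T (?c \<otimes>\<^bsub>gpow G d\<^esub> ?r) x"
    using act_mult[OF c r x] by simp
  finally show ?case unfolding eq .
qed

lemma block_act_eq:
  assumes "pmp_action (gpow G d) M T" and "g \<in> carrier G" "1 \<le> a" "b \<le> d" "x \<in> space M"
  shows "block_act G d T a b g x = T (seg G d a b g) x"
proof -
  have "(\<lambda>k\<in>{1..d}. if k \<in> set [a..<Suc b] then g else \<one>) = seg G d a b g"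
    by (auto simp: seg_def intro!: ext)
  then show ?thesis
    unfolding block_act_def using assms(2-)
    by (subst foldr_coord_act[OF assms(1), where g = "\<lambda>_. g"]) (auto simp del: upt_Suc)
qed

text \<open>For \<open>a \<le> m\<close> the modified action does not differ from the original on
  the segment from \<open>a\<close> to \<open>d\<close>: coordinates \<open>a\<close> to
  \<open>m - 1\<close> act as before, and entry \<open>m\<close> acts through the whole block from
  \<open>m\<close> to \<open>d\<close>. This makes the second projection of the self-joining
  equivariant as well.\<close>

lemma tilde_act_seg:
  assumes A: "pmp_action (gpow G d) M T" and g: "g \<in> carrier G" and "1 \<le> a" "a \<le> m" "m \<le> d" and x: "x \<in> space M"
  shows "tilde_act G d T m (seg G d a d g) x = T (seg G d a d g) x"
proof -
  let ?s = "seg G d a d g"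
  \<comment> \<open>The entries below \<open>m\<close> and the block from \<open>m\<close> on
    multiply to the segment itself.\<close>
  let ?c = "\<lambda>k\<in>{1..d}. if k \<in> set [1..<m] then ?s k else \<one>" and ?r = "seg G d m d (?s m)"
  have sm: "?s m = g" and sc: "?s i \<in> carrier G" if "i \<in> {1..d}" for i
    using assms that by (auto simp: seg_def)
  have gm: "?s m \<in> carrier G" using g assms by (simp add: seg_def)
  have r: "?r \<in> carrier (gpow G d)" using gm by (rule seg_carrier)
  have c: "?c \<in> carrier (gpow G d)" using sc by (auto simp del: mult_product_group)
  have eq: "?c \<otimes>\<^bsub>gpow G d\<^esub> ?r = ?s"
    using assms by (auto simp: seg_def intro!: ext)
  have "tilde_act G d T m ?s x = foldr (\<lambda>i \<phi>. coord_act G d T i (?s i) \<circ> \<phi>) [1..<m] id (T ?r x)"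
    unfolding tilde_act_def using block_act_eq[OF A gm _ _ x] assms by simp
  also have "\<dots> = T ?c (T ?r x)"
    using assms sc by (intro foldr_coord_act[OF A]) (auto intro: pmp_action.act_space[OF A r x])
  also have "\<dots> = T ?s x"
    using pmp_action.act_mult[OF A c r x] by (simp only: eq)
  finally show ?thesis .
qed

end

lemma measure_preserving_prob_AE:
  assumes "t \<in> M \<rightarrow>\<^sub>M N" "distr M N t = N" "AE x in N. P x"
  shows "AE x in M. P (t x)"
  using AE_distrD[OF assms(1), of P] assms(3) unfolding assms(2) by simp

section \<open>Cube functions\<close>

definition cube_fun :: "(nat \<Rightarrow> 'a \<Rightarrow> 'a \<times> 'a) \<Rightarrow> nat \<Rightarrow> ('a \<Rightarrow> complex) \<Rightarrow> 'a \<Rightarrow> complex" where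
  "cube_fun \<alpha> j f y =
     (\<Prod>\<eta>\<in>{1..j} \<rightarrow>\<^sub>E {0, 1}. (cnj ^^ ((\<Sum>i\<in>{1..j}. \<eta> i) mod 2)) (f (tower_proj \<alpha> \<eta> j y)))"

lemma cube_integral_eq: "cube_integral j N \<alpha> f = (\<integral>y. cube_fun \<alpha> j f y \<partial>N)"
  by (simp add: cube_integral_def cube_fun_def)

lemma cnj_funpow_mod_2: "cnj ^^ (n mod 2) = (if even n then id else cnj)"
  by (cases "even n") (simp_all add: odd_iff_mod_2_eq_one even_iff_mod_2_eq_zero fun_eq_iff)

lemma tower_proj_cong: "(\<And>i. i \<in> {1..j} \<Longrightarrow> \<eta> i = \<eta>' i) \<Longrightarrow> tower_proj \<alpha> \<eta> j = tower_proj \<alpha> \<eta>' j"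
  by (induction j) auto

lemma cube_fun_0: "cube_fun \<alpha> 0 f = f"
  by (auto simp: cube_fun_def)

text \<open>The product is split by the last entry of \<open>\<eta>\<close>: entry 0 projects to the
  first coordinate, entry 1 to the second and adds one conjugation.\<close>

lemma cube_fun_Suc:
  "cube_fun \<alpha> (Suc j) f y = cube_fun \<alpha> j f (fst (\<alpha> (Suc j) y)) * cnj (cube_fun \<alpha> j f (snd (\<alpha> (Suc j) y)))"
proof -
  let ?E = "{1..j} \<rightarrow>\<^sub>E {0, 1::nat}"
  let ?t = "\<lambda>k \<eta> y. (cnj ^^ ((\<Sum>i\<in>{1..k}. \<eta> i) mod 2)) (f (tower_proj \<alpha> \<eta> k y))"
  have E: "{1..Suc j} \<rightarrow>\<^sub>E {0, 1::nat} = (\<lambda>(e, \<eta>). \<eta>(Suc j := e)) ` ({0, 1} \<times> ?E)"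
    using PiE_insert_eq[of "Suc j" "{1..j}" "\<lambda>_. {0, 1::nat}"] by (simp add: atLeastAtMostSuc_conv)
  have inj: "inj_on (\<lambda>(e, \<eta>). \<eta>(Suc j := e)) ({0, 1} \<times> ?E)"
    using inj_combinator[of "Suc j" "{1..j}" "\<lambda>_. {0, 1::nat}"] by simp
  \<comment> \<open>Level \<open>j\<close> does not see entry \<open>Suc j\<close>.\<close>
  have p: "tower_proj \<alpha> (\<eta>(Suc j := e)) j = tower_proj \<alpha> \<eta> j" for \<eta> e
    by (rule tower_proj_cong) auto
  have s: "(\<Sum>i\<in>{1..j}. (\<eta>(Suc j := e)) i) = (\<Sum>i\<in>{1..j}. \<eta> i)" for \<eta> :: "nat \<Rightarrow> nat" and e
    by (rule sum.cong) auto
  have t0: "?t (Suc j) (\<eta>(Suc j := 0)) y = ?t j \<eta> (fst (\<alpha> (Suc j) y))" for \<eta> :: "nat \<Rightarrow> nat"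
    by (simp add: s p cnj_funpow_mod_2 del: fun_upd_apply) simp
  have t1: "?t (Suc j) (\<eta>(Suc j := 1)) y = cnj (?t j \<eta> (snd (\<alpha> (Suc j) y)))" for \<eta> :: "nat \<Rightarrow> nat"
    by (simp add: s p cnj_funpow_mod_2 del: fun_upd_apply) simp
  have "cube_fun \<alpha> (Suc j) f y = (\<Prod>(e, \<eta>)\<in>{0, 1} \<times> ?E. ?t (Suc j) (\<eta>(Suc j := e)) y)"
    unfolding cube_fun_def E by (subst prod.reindex[OF inj]) (simp add: o_def case_prod_unfold)
  also have "\<dots> = (\<Prod>e\<in>{0, 1}. \<Prod>\<eta>\<in>?E. ?t (Suc j) (\<eta>(Suc j := e)) y)"
    by (rule prod.cartesian_product[symmetric])
  also have "\<dots> = (\<Prod>\<eta>\<in>?E. ?t (Suc j) (\<eta>(Suc j := 0)) y) * (\<Prod>\<eta>\<in>?E. ?t (Suc j) (\<eta>(Suc j := 1)) y)"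
    by simp
  also have "\<dots> = cube_fun \<alpha> j f (fst (\<alpha> (Suc j) y)) * cnj (cube_fun \<alpha> j f (snd (\<alpha> (Suc j) y)))"
    unfolding t0 t1 cube_fun_def cnj_prod ..
  finally show ?thesis .
qed

text \<open>Cube functions are multiplicative and commute with conjugation, so they carry
  differences of \<open>f\<close> to differences of the cube function.\<close>

lemma cube_fun_mult_cnj:
  "cube_fun \<alpha> j (\<lambda>x. f x * cnj (g x)) y = cube_fun \<alpha> j f y * cnj (cube_fun \<alpha> j g y)"
  by (induction j arbitrary: y) (simp_all add: cube_fun_0 cube_fun_Suc)

section \<open>Equivariant projections and cube integrals on the tower\<close>

locale tower = group G for G :: "('g, 'b) monoid_scheme" (structure) +
  fixes d :: nat and Y :: "nat \<Rightarrow> 'a measure" and S \<kappa> \<xi> \<alpha>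
  assumes tower: "is_tower G d Y S \<kappa> \<xi> \<alpha>"
begin

lemma action: "j \<le> d \<Longrightarrow> pmp_action (gpow G d) (Y j) (S j)"
  using tower by (intro pmp_action_of_space group_gpow) (simp add: is_tower_def)

lemma diagonal_action: "j \<le> d \<Longrightarrow> pmp_action G (Y j) (\<lambda>g. S j (seg G d a b g))"
  using pmp_action_hom[OF action is_group seg_hom] .

text \<open>For \<open>m = d - j - 1\<close> the subgroup used in the tower is the diagonal of
  coordinates \<open>d - j\<close> to \<open>d\<close>. This gives the disintegration over the
  invariant sets of an action of \<open>G\<close> that \<open>mean_ergodic\<close> requires.\<close>

lemma tower_disintegration:
  assumes "j < d"
  shows "disintegration (Y j) (inv_algebra (Y j) (\<lambda>g. S j (seg G d (d - j) d g)) (carrier G)) (\<kappa> j)"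
proof -
  have "inv_algebra (Y j) (\<lambda>g. S j (seg G d (d - j) d g)) (carrier G)
      = inv_algebra (Y j) (S j) (L_sub G (d - j - 1) d)"
    using assms L_sub_eq_range_seg[of "d - j - 1" d] by (simp add: inv_algebra_def Suc_diff_Suc)
  then show ?thesis
    using tower assms by (simp add: is_tower_def Let_def)
qed

lemma tower_disintegrated:
  assumes "j < d"
  shows "disintegrated (Y j) (inv_algebra (Y j) (\<lambda>g. S j (seg G d (d - j) d g)) (carrier G)) (\<kappa> j)"
proof -
  interpret pmp_action G "Y j" "\<lambda>g. S j (seg G d (d - j) d g)"
    using assms by (intro diagonal_action) simp
  show ?thesis
    by unfold_locales (rule subalgebra_inv_algebra, rule tower_disintegration[OF assms])
qed

lemma tower_factor:
  assumes "j < d"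
  shows "\<alpha> (Suc j) \<in> Y (Suc j) \<rightarrow>\<^sub>M rel_square (Y j) (\<kappa> j)"
    and "distr (Y (Suc j)) (rel_square (Y j) (\<kappa> j)) (\<alpha> (Suc j)) = rel_square (Y j) (\<kappa> j)"
    and "g \<in> H_sub G (d - j - 1) d \<Longrightarrow>
      AE y in Y (Suc j). map_prod (S j g) (tilde_act G d (S j) (d - j - 1) g) (\<alpha> (Suc j) y) = \<alpha> (Suc j) (S (Suc j) g y)"
  using tower assms by (auto simp: is_tower_def Let_def factor_map_def)

lemma rel_square_proj:
  assumes "j < d" "pr = fst \<or> pr = snd"
  shows "pr \<in> rel_square (Y j) (\<kappa> j) \<rightarrow>\<^sub>M Y j" and "distr (rel_square (Y j) (\<kappa> j)) (Y j) pr = Y j"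
proof -
  interpret disintegrated "Y j" "inv_algebra (Y j) (\<lambda>g. S j (seg G d (d - j) d g)) (carrier G)" "\<kappa> j"
    by (rule tower_disintegrated[OF assms(1)])
  show "pr \<in> rel_square (Y j) (\<kappa> j) \<rightarrow>\<^sub>M Y j"
    using assms(2) measurable_cong_sets[OF sets_rel_square refl] by auto
  show "distr (rel_square (Y j) (\<kappa> j)) (Y j) pr = Y j"
    using assms(2) distr_rel_square by auto
qed

lemma tower_step:
  assumes "j < d" "pr = fst \<or> pr = snd"
  shows "(\<lambda>y. pr (\<alpha> (Suc j) y)) \<in> Y (Suc j) \<rightarrow>\<^sub>M Y j" and "distr (Y (Suc j)) (Y j) (\<lambda>y. pr (\<alpha> (Suc j) y)) = Y j"
proof -
  note p = rel_square_proj[OF assms] and t = tower_factor(1,2)[OF assms(1)]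
  show "(\<lambda>y. pr (\<alpha> (Suc j) y)) \<in> Y (Suc j) \<rightarrow>\<^sub>M Y j"
    using measurable_compose[OF t(1) p(1)] .
  show "distr (Y (Suc j)) (Y j) (\<lambda>y. pr (\<alpha> (Suc j) y)) = Y j"
    using distr_distr[OF p(1) t(1)] t(2) p(2) by (simp add: o_def)
qed

lemma tower_proj_preserving:
  assumes "j \<le> d"
  shows "tower_proj \<alpha> \<eta> j \<in> Y j \<rightarrow>\<^sub>M Y 0 \<and> distr (Y j) (Y 0) (tower_proj \<alpha> \<eta> j) = Y 0"
  using assms
proof (induction j)
  case 0
  show ?case by (simp add: id_def distr_id)
next
  case (Suc j)
  define pr :: "'a \<times> 'a \<Rightarrow> 'a" where "pr = (if \<eta> (Suc j) = 0 then fst else snd)"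
  have pr: "j < d" "pr = fst \<or> pr = snd" using Suc by (auto simp: pr_def)
  have eq: "tower_proj \<alpha> \<eta> (Suc j) = tower_proj \<alpha> \<eta> j \<circ> (\<lambda>y. pr (\<alpha> (Suc j) y))"
    by (auto simp: pr_def)
  have IH: "tower_proj \<alpha> \<eta> j \<in> Y j \<rightarrow>\<^sub>M Y 0" "distr (Y j) (Y 0) (tower_proj \<alpha> \<eta> j) = Y 0"
    using Suc by auto
  show ?case
    unfolding eq using measurable_comp[OF tower_step(1)[OF pr] IH(1)]
      distr_distr[OF IH(1) tower_step(1)[OF pr]] tower_step(2)[OF pr] IH(2) by (simp only: simp_thms)
qed

text \<open>In the step from level \<open>Suc j\<close> down to \<open>j\<close> the parameter
  \<open>m = d - j - 1\<close> is still at least \<open>a\<close>. By \<open>tilde_act_seg\<close>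
  both coordinates then move by the original block action, so either projection intertwines
  it.\<close>

lemma tower_proj_equivariant:
  assumes "j \<le> d - a" "1 \<le> a" "a \<le> d" and g: "g \<in> carrier G"
  shows "AE y in Y j. tower_proj \<alpha> \<eta> j (S j (seg G d a d g) y) = S 0 (seg G d a d g) (tower_proj \<alpha> \<eta> j y)"
  using assms(1)
proof (induction j)
  case (Suc j)
  let ?s = "seg G d a d g"
  define pr :: "'a \<times> 'a \<Rightarrow> 'a" where "pr = (if \<eta> (Suc j) = 0 then fst else snd)"
  have j: "j < d" using Suc assms by auto
  have pr: "pr = fst \<or> pr = snd" by (auto simp: pr_def)
  have eq: "tower_proj \<alpha> \<eta> (Suc j) y = tower_proj \<alpha> \<eta> j (pr (\<alpha> (Suc j) y))" for y
    by (auto simp: pr_def)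
  have fs: "(\<lambda>y. fst (\<alpha> (Suc j) y)) \<in> Y (Suc j) \<rightarrow>\<^sub>M Y j" "(\<lambda>y. snd (\<alpha> (Suc j) y)) \<in> Y (Suc j) \<rightarrow>\<^sub>M Y j"
    using tower_step(1)[OF j] by blast+
  have "AE y in Y (Suc j). map_prod (S j ?s) (tilde_act G d (S j) (d - j - 1) ?s) (\<alpha> (Suc j) y) = \<alpha> (Suc j) (S (Suc j) ?s y)"
    using Suc.prems assms by (intro tower_factor(3)[OF j] seg_in_H_sub) auto
  \<comment> \<open>The induction hypothesis on level \<open>j\<close> is pulled back along a
    measure-preserving map.\<close>
  moreover have "AE y in Y (Suc j). tower_proj \<alpha> \<eta> j (S j ?s (pr (\<alpha> (Suc j) y))) = S 0 ?s (tower_proj \<alpha> \<eta> j (pr (\<alpha> (Suc j) y)))"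
    using Suc by (intro measure_preserving_prob_AE[OF tower_step[OF j pr]]) auto
  ultimately show ?case
    using AE_space
  proof eventually_elim
    case (elim y)
    have "snd (\<alpha> (Suc j) y) \<in> space (Y j)"
      using measurable_space[OF fs(2) elim(3)] .
    then have "tilde_act G d (S j) (d - j - 1) ?s (snd (\<alpha> (Suc j) y)) = S j ?s (snd (\<alpha> (Suc j) y))"
      using Suc.prems assms j by (intro tilde_act_seg[OF action g]) auto
    then have "pr (\<alpha> (Suc j) (S (Suc j) ?s y)) = S j ?s (pr (\<alpha> (Suc j) y))"
      using pr elim(1) by (auto simp: map_prod_def case_prod_unfold prod_eq_iff)
    then show ?case
      using elim(2) by (simp only: eq)
  qed
qed simp

lemma cube_fun_unit:
  assumes "j \<le> d" "f \<in> unit_meas (Y 0)"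
  shows "cube_fun \<alpha> j f \<in> unit_meas (Y j)"
proof -
  have "(\<lambda>y. (cnj ^^ (n mod 2)) (f (tower_proj \<alpha> \<eta> j y))) \<in> unit_meas (Y j)" for n \<eta>
    using unit_meas_comp[OF assms(2), of "tower_proj \<alpha> \<eta> j" "Y j"] tower_proj_preserving[OF assms(1), of \<eta>]
    by (auto simp: cnj_funpow_mod_2 intro: unit_meas_cnj)
  then show ?thesis
    unfolding cube_fun_def[abs_def] by (intro unit_meas_prod)
qed

text \<open>There are finitely many \<open>\<eta>\<close>, so the exceptional sets of all
  projections can be discarded together.\<close>

lemma cube_fun_equivariant:
  assumes "j \<le> d - a" "1 \<le> a" "a \<le> d" and g: "g \<in> carrier G"
  shows "AE y in Y j. cube_fun \<alpha> j f (S j (seg G d a d g) y) = cube_fun \<alpha> j (\<lambda>x. f (S 0 (seg G d a d g) x)) y"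
proof -
  have "AE y in Y j. \<forall>\<eta>\<in>{1..j} \<rightarrow>\<^sub>E {0, 1}. tower_proj \<alpha> \<eta> j (S j (seg G d a d g) y) = S 0 (seg G d a d g) (tower_proj \<alpha> \<eta> j y)"
    by (subst AE_ball_countable) (auto intro!: countable_finite finite_PiE tower_proj_equivariant assms)
  then show ?thesis
    by eventually_elim (simp add: cube_fun_def)
qed

text \<open>The projections preserve the measure, so null sets pull back to null sets. This permits
  changing \<open>f\<close> on a null set.\<close>

lemma cube_integral_cong_AE:
  assumes "j \<le> d" "f \<in> borel_measurable (Y 0)" "f' \<in> borel_measurable (Y 0)" "AE x in Y 0. f x = f' x"
  shows "cube_integral j (Y j) \<alpha> f = cube_integral j (Y j) \<alpha> f'"
proof -
  have "AE y in Y j. \<forall>\<eta>\<in>{1..j} \<rightarrow>\<^sub>E {0, 1}. f (tower_proj \<alpha> \<eta> j y) = f' (tower_proj \<alpha> \<eta> j y)"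
    using tower_proj_preserving[OF assms(1)]
    by (subst AE_ball_countable)
      (auto intro!: countable_finite finite_PiE measure_preserving_prob_AE[OF _ _ assms(4)])
  then have ae: "AE y in Y j. cube_fun \<alpha> j f y = cube_fun \<alpha> j f' y"
    by eventually_elim (simp add: cube_fun_def)
  have "cube_fun \<alpha> j u \<in> borel_measurable (Y j)" if "u \<in> borel_measurable (Y 0)" for u
  proof -
    have "(\<lambda>y. (cnj ^^ (n mod 2)) (u (tower_proj \<alpha> \<eta> j y))) \<in> borel_measurable (Y j)" for n \<eta>
      using measurable_compose[OF conjunct1[OF tower_proj_preserving[OF assms(1)]] that, of \<eta>]
      by (auto simp: cnj_funpow_mod_2 intro: borel_measurable_continuous_on continuous_intros)
    then show ?thesis
      unfolding cube_fun_def[abs_def] by (intro borel_measurable_prod)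
  qed
  then show ?thesis
    unfolding cube_integral_eq using assms ae by (intro integral_cong_AE) auto
qed

text \<open>The map \<open>\<alpha> (Suc j)\<close> carries the measure to the self-joining, where
  the next cube function is a product of the present one and its conjugate;
  \<open>integral_rel_square\<close> evaluates the integral.\<close>

lemma cube_integral_Suc:
  assumes "j < d" and f: "f \<in> unit_meas (Y 0)"
  shows "cube_integral (Suc j) (Y (Suc j)) \<alpha> f = of_real (\<integral>x. (cmod (\<integral>y. cube_fun \<alpha> j f y \<partial>\<kappa> j x))\<^sup>2 \<partial>Y j)"
proof -
  interpret disintegrated "Y j" "inv_algebra (Y j) (\<lambda>g. S j (seg G d (d - j) d g)) (carrier G)" "\<kappa> j"
    by (rule tower_disintegrated[OF assms(1)])
  let ?R = "rel_square (Y j) (\<kappa> j)" and ?c = "cube_fun \<alpha> j f"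
  have c: "?c \<in> unit_meas (Y j)" using assms by (intro cube_fun_unit) auto
  have "(\<lambda>z. ?c (fst z) * cnj (?c (snd z))) \<in> unit_meas ?R"
    using rel_square_proj(1)[OF assms(1)] by (intro unit_meas_mult unit_meas_cnj unit_meas_comp[OF c]) auto
  then have "(\<integral>y. ?c (fst (\<alpha> (Suc j) y)) * cnj (?c (snd (\<alpha> (Suc j) y))) \<partial>Y (Suc j)) = (\<integral>z. ?c (fst z) * cnj (?c (snd z)) \<partial>?R)"
    using integral_distr[OF tower_factor(1)[OF assms(1)], of "\<lambda>z. ?c (fst z) * cnj (?c (snd z))"] tower_factor(2)[OF assms(1)]
    by (simp add: unit_meas_measurable)
  then show ?thesis
    using integral_rel_square[OF c] by (simp add: cube_integral_eq cube_fun_Suc)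
qed

end

section \<open>Van der Corput's inequality and the induction\<close>

text \<open>By the Folner property each \<open>u g\<close> may be replaced by its mean over the
  translates from \<open>K\<close>. Jensen's inequality in \<open>g\<close> and expansion of the
  square then leave only correlations of pairs of translates.\<close>

lemma (in prob_space) van_der_Corput:
  fixes u :: "'g \<Rightarrow> 'a \<Rightarrow> complex"
  assumes G: "group G" and F: "left_Folner G F"
    and u: "\<And>g. g \<in> carrier G \<Longrightarrow> u g \<in> unit_meas M"
    and K: "finite K" "K \<noteq> {}" "K \<subseteq> carrier G" and "e > 0"
  shows "\<forall>\<^sub>F n in sequentially.
    (\<integral>x. (cmod (mean (F n) (\<lambda>g. u g x)))\<^sup>2 \<partial>M) \<le>
      mean K (\<lambda>h. mean K (\<lambda>k.
        Re (mean (F n) (\<lambda>g. \<integral>x. u (h \<otimes>\<^bsub>G\<^esub> g) x * cnj (u (k \<otimes>\<^bsub>G\<^esub> g) x) \<partial>M)))) + e"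
proof -
  interpret G: group G by fact
  define r where "r h n = real (card (sym_diff (h <#\<^bsub>G\<^esub> F n) (F n))) / real (card (F n))" for h n
  have F': "finite (F n)" "F n \<noteq> {}" "\<And>g. g \<in> F n \<Longrightarrow> g \<in> carrier G" for n
    using F by (auto simp: left_Folner_def)
  have K': "\<And>h. h \<in> K \<Longrightarrow> h \<in> carrier G" using K by auto
  \<comment> \<open>A distance of \<open>e / 2\<close> between the averages costs \<open>e\<close>
    between their squares.\<close>
  have "\<forall>\<^sub>F n in sequentially. \<forall>h\<in>K. r h n < e / 2"
  proof (intro eventually_ball_finite[OF K(1)] ballI)
    fix h assume "h \<in> K"
    then have "r h \<longlonglongrightarrow> 0"
      using F K' by (auto simp: left_Folner_def r_def[abs_def])
    then show "\<forall>\<^sub>F n in sequentially. r h n < e / 2"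
      using \<open>e > 0\<close> by (intro order_tendstoD) auto
  qed
  then show ?thesis
  proof eventually_elim
    case (elim n)
    let ?a = "\<lambda>x. mean (F n) (\<lambda>g. u g x)"
    let ?v = "\<lambda>g x. mean K (\<lambda>h. u (h \<otimes>\<^bsub>G\<^esub> g) x)"
    let ?b = "\<lambda>x. mean (F n) (\<lambda>g. ?v g x)"
    have uhg: "u (h \<otimes>\<^bsub>G\<^esub> g) \<in> unit_meas M" if "h \<in> K" "g \<in> F n" for h g
      using that K' F'(3) by (intro u) auto
    have a: "?a \<in> unit_meas M" using F'(3) by (intro unit_meas_mean u)
    have v: "?v g \<in> unit_meas M" if "g \<in> F n" for g using uhg that by (intro unit_meas_mean)
    have b: "?b \<in> unit_meas M" by (rule unit_meas_mean[OF v])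
    have close: "cmod (?b x - ?a x) \<le> e / 2" for x
    proof -
      have "?b x - ?a x = mean K (\<lambda>h. mean (F n) (\<lambda>g. u (h \<otimes>\<^bsub>G\<^esub> g) x) - ?a x)"
        unfolding mean_diff mean_const[OF K(1,2)] by (subst mean_swap) (rule refl)
      also have "cmod \<dots> \<le> e / 2"
      proof (rule norm_mean_le_bound)
        fix h assume h: "h \<in> K"
        have "cmod (mean (F n) (\<lambda>g. u (h \<otimes>\<^bsub>G\<^esub> g) x) - ?a x) \<le> r h n"
          unfolding r_def by (rule Folner_shift_le[OF G F K'[OF h] unit_meas_le[OF u]])
        then show "cmod (mean (F n) (\<lambda>g. u (h \<otimes>\<^bsub>G\<^esub> g) x) - ?a x) \<le> e / 2"
          using elim h by fastforce
      qed (use \<open>e > 0\<close> in simp)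
      finally show ?thesis .
    qed
    have iv: "integrable M (\<lambda>x. (cmod (?v g x))\<^sup>2)" if "g \<in> F n" for g
      using v[OF that] by (rule unit_meas_sq_integrable)
    have "(\<integral>x. (cmod (?a x))\<^sup>2 \<partial>M) \<le> (\<integral>x. (cmod (?b x))\<^sup>2 + e \<partial>M)"
      using unit_meas_sq_integrable[OF a] unit_meas_sq_integrable[OF b]
      by (intro integral_mono square_norm_le_of_close unit_meas_le[OF a] unit_meas_le[OF b] close) auto
    also have "\<dots> = (\<integral>x. (cmod (?b x))\<^sup>2 \<partial>M) + e"
      using unit_meas_sq_integrable[OF b] by (simp add: prob_space)
    also have "(\<integral>x. (cmod (?b x))\<^sup>2 \<partial>M) \<le> (\<integral>x. mean (F n) (\<lambda>g. (cmod (?v g x))\<^sup>2) \<partial>M)"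
      using unit_meas_sq_integrable[OF b] iv
      by (intro integral_mono norm_mean_square_le) (auto simp: mean_def)
    also have "\<dots> = mean (F n) (\<lambda>g. \<integral>x. (cmod (?v g x))\<^sup>2 \<partial>M)"
      by (rule integral_mean[OF iv])
    also have "\<dots> = mean (F n) (\<lambda>g. mean K (\<lambda>h. mean K (\<lambda>k. Re (\<integral>x. u (h \<otimes>\<^bsub>G\<^esub> g) x * cnj (u (k \<otimes>\<^bsub>G\<^esub> g) x) \<partial>M))))"
    proof (rule mean_cong)
      fix g assume g: "g \<in> F n"
      have i: "integrable M (\<lambda>x. u (h \<otimes>\<^bsub>G\<^esub> g) x * cnj (u (k \<otimes>\<^bsub>G\<^esub> g) x))" if "h \<in> K" "k \<in> K" for h k
        using that g by (intro unit_meas_integrable unit_meas_mult unit_meas_cnj uhg)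
      have "complex_of_real (\<integral>x. (cmod (?v g x))\<^sup>2 \<partial>M) = (\<integral>x. complex_of_real ((cmod (?v g x))\<^sup>2) \<partial>M)"
        by (rule integral_complex_of_real[symmetric])
      \<comment> \<open>The squared modulus is the product with the conjugate, hence a double
        mean.\<close>
      also have "\<dots> = (\<integral>x. mean K (\<lambda>h. mean K (\<lambda>k. u (h \<otimes>\<^bsub>G\<^esub> g) x * cnj (u (k \<otimes>\<^bsub>G\<^esub> g) x))) \<partial>M)"
        unfolding complex_norm_square mean_cnj mean_mult_left mean_mult_right ..
      also have "\<dots> = mean K (\<lambda>h. mean K (\<lambda>k. \<integral>x. u (h \<otimes>\<^bsub>G\<^esub> g) x * cnj (u (k \<otimes>\<^bsub>G\<^esub> g) x) \<partial>M))"
        using i by (subst integral_mean, simp add: mean_def) (intro mean_cong integral_mean)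
      finally have "complex_of_real (\<integral>x. (cmod (?v g x))\<^sup>2 \<partial>M) = \<dots>" .
      from arg_cong[OF this, of Re]
      show "(\<integral>x. (cmod (?v g x))\<^sup>2 \<partial>M) = mean K (\<lambda>h. mean K (\<lambda>k. Re (\<integral>x. u (h \<otimes>\<^bsub>G\<^esub> g) x * cnj (u (k \<otimes>\<^bsub>G\<^esub> g) x) \<partial>M)))"
        by (simp only: mean_Re Re_complex_of_real)
    qed
    also have "\<dots> = mean K (\<lambda>h. mean K (\<lambda>k. Re (mean (F n) (\<lambda>g. \<integral>x. u (h \<otimes>\<^bsub>G\<^esub> g) x * cnj (u (k \<otimes>\<^bsub>G\<^esub> g) x) \<partial>M))))"
      unfolding mean_Re by (subst mean_swap) (intro mean_cong mean_swap)
    finally show ?case by simp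
  qed
qed

section \<open>Differencing and the induction on the level\<close>

locale Folner_tower = tower G d Y S \<kappa> \<xi> \<alpha>
  for G :: "('g, 'b) monoid_scheme" (structure) and d :: nat and Y :: "nat \<Rightarrow> 'a measure" and S \<kappa> \<xi> \<alpha> +
  fixes F :: "nat \<Rightarrow> 'g set"
  assumes F_Folner: "left_Folner G F"
begin

sublocale X: pmp_action "gpow G d" "Y 0" "S 0"
  by (rule action) simp

text \<open>The ergodic average with each composite of coordinate maps replaced by one group
  element; the two agree on the space.\<close>

definition seg_avg :: "nat \<Rightarrow> (nat \<Rightarrow> 'a \<Rightarrow> complex) \<Rightarrow> nat \<Rightarrow> 'a \<Rightarrow> complex" where
  "seg_avg j f n x = mean (F n) (\<lambda>g. \<Prod>i\<in>{d - j + 1..d}. f i (S 0 (seg G d (d - j + 1) i g) x))"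

lemma F_carrier: "g \<in> F n \<Longrightarrow> g \<in> carrier G" and F_finite: "finite (F n)" and F_nonempty: "F n \<noteq> {}"
  using F_Folner by (auto simp: left_Folner_def)

lemma ergodic_avg_eq:
  assumes "j \<le> d" "x \<in> space (Y 0)"
  shows "ergodic_avg G d (S 0) F j f n x = seg_avg j f n x"
proof -
  have "(\<Prod>i\<in>{d - j + 1..d}. f i (block_act G d (S 0) (d - j + 1) i g x)) =
      (\<Prod>i\<in>{d - j + 1..d}. f i (S 0 (seg G d (d - j + 1) i g) x))" if "g \<in> F n" for g
    using F_carrier[OF that] assms by (intro prod.cong refl) (simp add: block_act_eq[OF X.pmp_action_axioms])
  then show ?thesis
    by (simp add: ergodic_avg_def seg_avg_def mean_def)
qed

lemma seg_product_unit:
  assumes "g \<in> carrier G" "\<And>i. i \<in> I \<Longrightarrow> f i \<in> unit_meas (Y 0)"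
  shows "(\<lambda>x. \<Prod>i\<in>I. f i (S 0 (seg G d a i g) x)) \<in> unit_meas (Y 0)"
  using assms X.act_measurable[OF seg_carrier[OF assms(1)]] by (intro unit_meas_prod) (auto intro: unit_meas_comp)

lemma seg_avg_unit:
  assumes "\<And>i. i \<in> {d - j + 1..d} \<Longrightarrow> f i \<in> unit_meas (Y 0)"
  shows "seg_avg j f n \<in> unit_meas (Y 0)"
  unfolding seg_avg_def[abs_def] using assms F_carrier by (intro unit_meas_mean seg_product_unit)

text \<open>The multiplicative difference produced by van der Corput's inequality.\<close>

definition diff_fun :: "nat \<Rightarrow> 'g \<Rightarrow> 'g \<Rightarrow> (nat \<Rightarrow> 'a \<Rightarrow> complex) \<Rightarrow> nat \<Rightarrow> 'a \<Rightarrow> complex" where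
  "diff_fun a h k f i x = f i (S 0 (seg G d a i h) x) * cnj (f i (S 0 (seg G d a i k) x))"

lemma diff_fun_unit:
  assumes "h \<in> carrier G" "k \<in> carrier G" "f i \<in> unit_meas (Y 0)"
  shows "diff_fun a h k f i \<in> unit_meas (Y 0)"
  unfolding diff_fun_def[abs_def]
  using assms X.act_measurable[OF seg_carrier]
  by (intro unit_meas_mult unit_meas_cnj unit_meas_comp[OF assms(3)]) auto

text \<open>Moving the action of coordinate \<open>a\<close> into a measure-preserving change of
  variables leaves blocks that start at \<open>a + 1\<close>. The factor with index \<open>a\<close>
  no longer depends on \<open>g\<close>, leaves the mean and is discarded by
  \<open>integral_mult_le_l2_norm\<close>.\<close>

lemma correlation_le:
  assumes j: "j < d" and h: "h \<in> carrier G" and k: "k \<in> carrier G"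
    and f: "\<And>i. i \<in> {d - j..d} \<Longrightarrow> f i \<in> unit_meas (Y 0)"
  defines "a \<equiv> d - j"
  defines "u \<equiv> \<lambda>g x. \<Prod>i\<in>{a..d}. f i (S 0 (seg G d a i g) x)"
  shows "Re (mean (F n) (\<lambda>g. \<integral>x. u (h \<otimes> g) x * cnj (u (k \<otimes> g) x) \<partial>Y 0))
    \<le> l2_norm (Y 0) (seg_avg j (diff_fun a h k f) n)"
proof -
  let ?w = "diff_fun a h k f"
  have w: "?w i \<in> unit_meas (Y 0)" if "i \<in> {a..d}" for i
    using that f h k by (intro diff_fun_unit) (auto simp: a_def)
  have wa: "?w a \<in> unit_meas (Y 0)" using w j by (auto simp: a_def)
  let ?p = "\<lambda>g x. \<Prod>i\<in>{Suc a..d}. ?w i (S 0 (seg G d (Suc a) i g) x)"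
  have p: "?p g \<in> unit_meas (Y 0)" if "g \<in> carrier G" for g
    using that w by (intro seg_product_unit) auto
  have eq: "(\<integral>x. u (h \<otimes> g) x * cnj (u (k \<otimes> g) x) \<partial>Y 0) = (\<integral>x. ?w a x * ?p g x \<partial>Y 0)" if g: "g \<in> carrier G" for g
  proof -
    note sc = seg_carrier[OF g, of d]
    have s: "S 0 (seg G d a i (l \<otimes> g)) x = S 0 (seg G d a i l) (S 0 (seg G d a i g) x)"
      if "l \<in> carrier G" "x \<in> space (Y 0)" for l i x
      using X.act_mult[OF seg_carrier[OF that(1)] seg_carrier[OF g] that(2)] hom_mult[OF seg_hom that(1) g] by simp
    have "u (h \<otimes> g) x * cnj (u (k \<otimes> g) x) = ?w a (S 0 (seg G d a a g) x) * ?p g (S 0 (seg G d a a g) x)"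
      if x: "x \<in> space (Y 0)" for x
    proof -
      let ?y = "S 0 (seg G d a a g) x"
      have y: "?y \<in> space (Y 0)" using X.act_space[OF sc x] .
      \<comment> \<open>\<open>seg\<close> is a homomorphism, so \<open>h\<close> and
        \<open>k\<close> act after \<open>g\<close> and combine into the differences.\<close>
      have "u (h \<otimes> g) x * cnj (u (k \<otimes> g) x) = (\<Prod>i\<in>{a..d}. ?w i (S 0 (seg G d a i g) x))"
        unfolding u_def diff_fun_def by (simp add: s h k x prod.distrib)
      also have "\<dots> = (\<Prod>i\<in>{a..d}. ?w i (S 0 (seg G d (Suc a) i g) ?y))"
      proof (intro prod.cong refl)
        fix i assume "i \<in> {a..d}"
        then have "a \<le> i" by simp
        have "S 0 (seg G d a i g) x = S 0 (seg G d (Suc a) i g) ?y"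
          by (subst seg_split[OF \<open>a \<le> i\<close> g]) (rule X.act_mult[OF sc sc x])
        then show "?w i (S 0 (seg G d a i g) x) = ?w i (S 0 (seg G d (Suc a) i g) ?y)"
          by (rule arg_cong)
      qed
      also have "{a..d} = insert a {Suc a..d}"
        using j by (auto simp: a_def)
      \<comment> \<open>For index \<open>a\<close> the remaining block is empty and acts as the
        identity.\<close>
      also have "(\<Prod>i\<in>insert a {Suc a..d}. ?w i (S 0 (seg G d (Suc a) i g) ?y)) = ?w a ?y * ?p g ?y"
        using X.act_one[OF y] by (simp add: seg_empty)
      finally show ?thesis .
    qed
    then have "(\<integral>x. u (h \<otimes> g) x * cnj (u (k \<otimes> g) x) \<partial>Y 0) =
        (\<integral>x. ?w a (S 0 (seg G d a a g) x) * ?p g (S 0 (seg G d a a g) x) \<partial>Y 0)"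
      by (intro Bochner_Integration.integral_cong refl)
    also have "\<dots> = (\<integral>x. ?w a x * ?p g x \<partial>Y 0)"
      by (rule X.integral_act[OF sc]) (rule unit_meas_measurable[OF unit_meas_mult[OF wa p[OF g]]])
    finally show ?thesis .
  qed
  have "mean (F n) (\<lambda>g. \<integral>x. u (h \<otimes> g) x * cnj (u (k \<otimes> g) x) \<partial>Y 0) = mean (F n) (\<lambda>g. \<integral>x. ?w a x * ?p g x \<partial>Y 0)"
    by (intro mean_cong eq F_carrier)
  also have "\<dots> = (\<integral>x. mean (F n) (\<lambda>g. ?w a x * ?p g x) \<partial>Y 0)"
    using F_carrier by (intro integral_mean[symmetric] X.unit_meas_integrable unit_meas_mult[OF wa p])
  also have "\<dots> = (\<integral>x. ?w a x * seg_avg j ?w n x \<partial>Y 0)"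
    unfolding mean_mult_left seg_avg_def by (simp add: a_def)
  finally have *: "mean (F n) (\<lambda>g. \<integral>x. u (h \<otimes> g) x * cnj (u (k \<otimes> g) x) \<partial>Y 0) = (\<integral>x. ?w a x * seg_avg j ?w n x \<partial>Y 0)" .
  show ?thesis
    unfolding * by (intro X.integral_mult_le_l2_norm wa seg_avg_unit w) (auto simp: a_def)
qed

lemma cube_Folner:
  assumes "j < d" "f \<in> unit_meas (Y 0)"
  shows "Folner_pmp_action G (Y j) (\<lambda>g. S j (seg G d (d - j) d g)) F (cube_fun \<alpha> j f)"
proof -
  interpret pmp_action G "Y j" "\<lambda>g. S j (seg G d (d - j) d g)"
    using assms by (intro diagonal_action) simp
  show ?thesis
    by unfold_locales (use F_Folner cube_fun_unit assms in auto)
qed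

text \<open>The common value of two computations: a finite double mean of cube integrals of
  differences, and a norm whose limit is given by the mean ergodic theorem.\<close>

definition cube_sq :: "nat \<Rightarrow> (nat \<Rightarrow> 'a \<Rightarrow> complex) \<Rightarrow> nat \<Rightarrow> real" where
  "cube_sq j f n = (\<integral>y. (cmod (mean (F n) (\<lambda>g. cube_fun \<alpha> j (f d) (S j (seg G d (d - j) d g) y))))\<^sup>2 \<partial>Y j)"

lemma cube_sq_tendsto:
  assumes "j < d" "f d \<in> unit_meas (Y 0)"
  shows "cube_sq j f \<longlonglongrightarrow> Re (cube_integral (Suc j) (Y (Suc j)) \<alpha> (f d))"
proof -
  interpret A: Folner_pmp_action G "Y j" "\<lambda>g. S j (seg G d (d - j) d g)" F "cube_fun \<alpha> j (f d)"
    by (rule cube_Folner[OF assms])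
  show ?thesis
    using A.mean_ergodic[OF tower_disintegration[OF assms(1)]] cube_integral_Suc[OF assms]
    by (simp add: A.sq_def A.orbit_mean_def cube_sq_def[abs_def])
qed

text \<open>On each positive level the cube integral is a squared norm.\<close>

lemma cube_nonneg:
  assumes "0 < j" "j \<le> d" "f \<in> unit_meas (Y 0)"
  shows "cube_integral j (Y j) \<alpha> f \<in> \<real>" "0 \<le> Re (cube_integral j (Y j) \<alpha> f)"
proof -
  obtain i where i: "j = Suc i" using assms(1) by (cases j) auto
  show "cube_integral j (Y j) \<alpha> f \<in> \<real>" "0 \<le> Re (cube_integral j (Y j) \<alpha> f)"
    using cube_integral_Suc[of i f] assms unfolding i by auto
qed

text \<open>Multiplicativity and equivariance turn the cube integral of a difference into a
  correlation of the cube function along its orbit; the double mean of these is the square of a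
  single mean.\<close>

lemma mean_cube_integral:
  assumes j: "j < d" and f: "f d \<in> unit_meas (Y 0)"
  shows "mean (F n) (\<lambda>h. mean (F n) (\<lambda>k. Re (cube_integral j (Y j) \<alpha> (diff_fun (d - j) h k f d)))) = cube_sq j f n"
proof -
  let ?s = "\<lambda>g. seg G d (d - j) d g" and ?c = "cube_fun \<alpha> j (f d)"
  interpret A: Folner_pmp_action G "Y j" "\<lambda>g. S j (?s g)" F ?c
    by (rule cube_Folner[OF j f])
  have cu: "(\<lambda>y. ?c (S j (?s h) y)) \<in> unit_meas (Y j)" if "h \<in> carrier G" for h
    using that by (intro unit_meas_comp[OF A.f_unit]) auto
  have *: "cube_integral j (Y j) \<alpha> (diff_fun (d - j) h k f d) = (\<integral>y. ?c (S j (?s h) y) * cnj (?c (S j (?s k) y)) \<partial>Y j)"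
    if h: "h \<in> carrier G" and k: "k \<in> carrier G" for h k
  proof -
    \<comment> \<open>The block starts at \<open>d - j\<close>, the largest value for which
      equivariance on level \<open>j\<close> is available.\<close>
    have "AE y in Y j. ?c (S j (?s g) y) = cube_fun \<alpha> j (\<lambda>x. f d (S 0 (?s g) x)) y" if "g \<in> carrier G" for g
      using j that by (intro cube_fun_equivariant) auto
    from this[OF h] this[OF k]
    have ae: "AE y in Y j. cube_fun \<alpha> j (diff_fun (d - j) h k f d) y = ?c (S j (?s h) y) * cnj (?c (S j (?s k) y))"
      unfolding diff_fun_def[abs_def] cube_fun_mult_cnj by eventually_elim simp
    have "cube_fun \<alpha> j (diff_fun (d - j) h k f d) \<in> unit_meas (Y j)"
      using j h k f by (intro cube_fun_unit diff_fun_unit) auto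
    then show ?thesis
      unfolding cube_integral_eq
      using ae unit_meas_mult[OF cu[OF h] unit_meas_cnj[OF cu[OF k]]]
      by (intro integral_cong_AE unit_meas_measurable)
  qed
  have i: "integrable (Y j) (\<lambda>y. ?c (S j (?s h) y) * cnj (?c (S j (?s k) y)))" if "h \<in> F n" "k \<in> F n" for h k
    using that by (intro A.unit_meas_integrable unit_meas_mult unit_meas_cnj cu F_carrier)
  have "complex_of_real (cube_sq j f n) =
      (\<integral>y. complex_of_real ((cmod (mean (F n) (\<lambda>g. ?c (S j (?s g) y))))\<^sup>2) \<partial>Y j)"
    unfolding cube_sq_def by (rule integral_complex_of_real[symmetric])
  also have "\<dots> = (\<integral>y. mean (F n) (\<lambda>h. mean (F n) (\<lambda>k. ?c (S j (?s h) y) * cnj (?c (S j (?s k) y)))) \<partial>Y j)"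
    unfolding complex_norm_square mean_cnj mean_mult_left mean_mult_right ..
  also have "\<dots> = mean (F n) (\<lambda>h. mean (F n) (\<lambda>k. \<integral>y. ?c (S j (?s h) y) * cnj (?c (S j (?s k) y)) \<partial>Y j))"
    using i by (subst integral_mean, simp add: mean_def) (intro mean_cong integral_mean)
  also have "\<dots> = mean (F n) (\<lambda>h. mean (F n) (\<lambda>k. cube_integral j (Y j) \<alpha> (diff_fun (d - j) h k f d)))"
    by (intro mean_cong) (simp add: * F_carrier)
  finally have "complex_of_real (cube_sq j f n) = \<dots>" .
  from arg_cong[OF this, of Re] show ?thesis
    by (simp only: mean_Re Re_complex_of_real)
qed

text \<open>An eventual bound by any \<open>B\<close> above the cube expression replaces the limit
  superior, so the induction hypothesis can be used for finitely many pairs \<open>h\<close>,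
  \<open>k\<close> at once.\<close>

lemma eventually_l2_norm_le:
  assumes "0 < j" "j \<le> d" "\<And>i. i \<in> {d - j + 1..d} \<Longrightarrow> f i \<in> unit_meas (Y 0)"
    and "Re (cube_integral j (Y j) \<alpha> (f d)) powr (1 / 2 ^ j) < B"
  shows "\<forall>\<^sub>F n in sequentially. l2_norm (Y 0) (seg_avg j f n) \<le> B"
  using assms
proof (induction j arbitrary: f B rule: nat_induct_non_zero)
  case 1
  have fd: "f d \<in> unit_meas (Y 0)" using 1 by auto
  let ?c = "Re (cube_integral 1 (Y 1) \<alpha> (f d))"
  have c: "sqrt ?c < B"
    using 1(3) cube_nonneg(2)[OF _ _ fd, of 1] 1 by (simp add: powr_half_sqrt)
  \<comment> \<open>For a single function the average is already an orbit average on the base, so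
    the limit is exact.\<close>
  have "l2_norm (Y 0) (seg_avg 1 f n) = sqrt (cube_sq 0 f n)" for n
    using 1 by (simp add: l2_norm_def seg_avg_def cube_sq_def cube_fun_0)
  moreover have "(\<lambda>n. sqrt (cube_sq 0 f n)) \<longlonglongrightarrow> sqrt ?c"
    using cube_sq_tendsto[of 0 f] fd 1 by (intro tendsto_real_sqrt) auto
  ultimately have "(\<lambda>n. l2_norm (Y 0) (seg_avg 1 f n)) \<longlonglongrightarrow> sqrt ?c" by simp
  from order_tendstoD(2)[OF this c] show ?case
    by eventually_elim simp
next
  case (Suc j)
  let ?c = "Re (cube_integral (Suc j) (Y (Suc j)) \<alpha> (f d))" and ?p = "1 / 2 ^ j :: real"
  have j: "j < d" "d - Suc j + 1 = d - j" using Suc.prems by auto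
  have f: "f i \<in> unit_meas (Y 0)" if "i \<in> {d - j..d}" for i
    using Suc.prems(2) that j by auto
  have fd: "f d \<in> unit_meas (Y 0)" using f by auto
  have c: "0 \<le> ?c" using cube_nonneg(2)[OF _ _ fd, of "Suc j"] Suc.prems by simp
  have B: "0 < B" using Suc.prems(3) by (rule le_less_trans[rotated]) simp
  \<comment> \<open>Squaring the norm lowers the exponent to that of level \<open>j\<close>.\<close>
  have "(?c powr (1 / 2 ^ Suc j))\<^sup>2 = ?c powr ?p"
    using c by (cases "?c = 0") (simp_all add: powr_realpow[symmetric] powr_powr)
  moreover have "(?c powr (1 / 2 ^ Suc j))\<^sup>2 < B\<^sup>2"
    using Suc.prems(3) by (intro power_strict_mono) auto
  ultimately have "?c powr ?p < B\<^sup>2" by simp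
  moreover have "(\<lambda>N. cube_sq j f N powr ?p) \<longlonglongrightarrow> ?c powr ?p"
    by (intro tendsto_powr' cube_sq_tendsto j fd tendsto_const) (auto simp: cube_sq_def)
  ultimately have "\<forall>\<^sub>F N in sequentially. cube_sq j f N powr ?p < B\<^sup>2"
    by (intro order_tendstoD(2))
  \<comment> \<open>The Folner set \<open>F N\<close> serves as the finite set of shifts. It is
    fixed before \<open>n\<close> tends to infinity.\<close>
  then obtain N where N: "cube_sq j f N powr ?p < B\<^sup>2"
    using eventually_happens'[OF sequentially_bot] by blast
  \<comment> \<open>Half of the gap, since an error \<open>e\<close> occurs twice: in the induction
    hypothesis and in van der Corput's inequality.\<close>
  define e where "e = (B\<^sup>2 - cube_sq j f N powr ?p) / 2"
  have e: "0 < e" using N by (simp add: e_def)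
  let ?w = "\<lambda>h k. diff_fun (d - j) h k f"
  define b where "b h k = Re (cube_integral j (Y j) \<alpha> (?w h k d)) powr ?p" for h k
  let ?u = "\<lambda>g x. \<Prod>i\<in>{d - j..d}. f i (S 0 (seg G d (d - j) i g) x)"
  have "\<forall>\<^sub>F n in sequentially. \<forall>h\<in>F N. \<forall>k\<in>F N. l2_norm (Y 0) (seg_avg j (?w h k) n) \<le> b h k + e"
  proof (intro eventually_ball_finite F_finite ballI)
    fix h k assume h: "h \<in> F N" and k: "k \<in> F N"
    show "\<forall>\<^sub>F n in sequentially. l2_norm (Y 0) (seg_avg j (?w h k) n) \<le> b h k + e"
    proof (rule Suc.IH)
      show "?w h k i \<in> unit_meas (Y 0)" if "i \<in> {d - j + 1..d}" for i
        using that h k F_carrier by (intro diff_fun_unit f) auto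
    qed (use j e in \<open>auto simp: b_def\<close>)
  qed
  moreover have "\<forall>\<^sub>F n in sequentially. (\<integral>x. (cmod (mean (F n) (\<lambda>g. ?u g x)))\<^sup>2 \<partial>Y 0) \<le>
      mean (F N) (\<lambda>h. mean (F N) (\<lambda>k. Re (mean (F n) (\<lambda>g. \<integral>x. ?u (h \<otimes> g) x * cnj (?u (k \<otimes> g) x) \<partial>Y 0)))) + e"
    using f by (intro X.van_der_Corput[OF is_group F_Folner] seg_product_unit F_finite F_nonempty e)
      (auto intro: F_carrier)
  ultimately show ?case
  proof eventually_elim
    case (elim n)
    have "(l2_norm (Y 0) (seg_avg (Suc j) f n))\<^sup>2 = (\<integral>x. (cmod (mean (F n) (\<lambda>g. ?u g x)))\<^sup>2 \<partial>Y 0)"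
      unfolding l2_norm_def seg_avg_def j by simp
    also note elim(2)
    also have "mean (F N) (\<lambda>h. mean (F N) (\<lambda>k. Re (mean (F n) (\<lambda>g. \<integral>x. ?u (h \<otimes> g) x * cnj (?u (k \<otimes> g) x) \<partial>Y 0))))
        \<le> mean (F N) (\<lambda>h. mean (F N) (\<lambda>k. b h k + e))"
    proof (intro mean_mono)
      fix h k assume h: "h \<in> F N" and k: "k \<in> F N"
      have "Re (mean (F n) (\<lambda>g. \<integral>x. ?u (h \<otimes> g) x * cnj (?u (k \<otimes> g) x) \<partial>Y 0)) \<le> l2_norm (Y 0) (seg_avg j (?w h k) n)"
        by (rule correlation_le[OF j(1) F_carrier[OF h] F_carrier[OF k] f])
      then show "Re (mean (F n) (\<lambda>g. \<integral>x. ?u (h \<otimes> g) x * cnj (?u (k \<otimes> g) x) \<partial>Y 0)) \<le> b h k + e"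
        using elim(1) h k by fastforce
    qed
    also have "mean (F N) (\<lambda>h. mean (F N) (\<lambda>k. b h k + e)) = mean (F N) (\<lambda>h. mean (F N) (b h)) + e"
      by (simp add: mean_add mean_const F_finite F_nonempty)
    finally have "(l2_norm (Y 0) (seg_avg (Suc j) f n))\<^sup>2 \<le> mean (F N) (\<lambda>h. mean (F N) (b h)) + e + e"
      by simp
    \<comment> \<open>Concavity moves the power outside the means, where the cube integrals add up
      to \<open>cube_sq\<close>.\<close>
    moreover have "mean (F N) (\<lambda>h. mean (F N) (b h)) \<le> cube_sq j f N powr ?p"
      unfolding mean_cube_integral[of j f N, OF j(1) fd, symmetric] b_def using Suc.hyps j fd F_carrier
      by (intro mean_mean_powr_le cube_nonneg diff_fun_unit) auto
    moreover have "cube_sq j f N powr ?p + e + e = B\<^sup>2"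
      by (simp add: e_def)
    ultimately have "(l2_norm (Y 0) (seg_avg (Suc j) f n))\<^sup>2 \<le> B\<^sup>2"
      by linarith
    then show ?case
      by (rule power2_le_imp_le) (use B in simp)
  qed
qed

end

section \<open>Passage from almost everywhere bounds to functions with values in the unit
  disc\<close>

theorem theorem4p6:
  fixes G :: "('g, 'b) monoid_scheme"
    and F :: "nat \<Rightarrow> 'g set"
    and d j :: nat
    and X :: "'a measure"
    and T :: "(nat \<Rightarrow> 'g) \<Rightarrow> 'a \<Rightarrow> 'a"
    and Y :: "nat \<Rightarrow> 'a measure"
    and S :: "nat \<Rightarrow> (nat \<Rightarrow> 'g) \<Rightarrow> 'a \<Rightarrow> 'a"
    and \<kappa> :: "nat \<Rightarrow> 'a \<Rightarrow> 'a measure"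
    and \<xi> :: "nat \<Rightarrow> 'a \<Rightarrow> 'a"
    and \<alpha> :: "nat \<Rightarrow> 'a \<Rightarrow> 'a \<times> 'a"
    and f :: "nat \<Rightarrow> 'a \<Rightarrow> complex"
  assumes "group G" and "countable (carrier G)"
    and "left_Folner G F"
    and "1 \<le> d"
    and "pmp_space (gpow G d) X T"
    and "1 \<le> j" and "j \<le> d"
    and "Y 0 = X" and "S 0 = T"
    and "is_tower G d Y S \<kappa> \<xi> \<alpha>"
    and "\<And>i. i \<in> {d - j + 1..d} \<Longrightarrow> f i \<in> borel_measurable X"
    and "\<And>i. i \<in> {d - j + 1..d} \<Longrightarrow> AE x in X. cmod (f i x) \<le> 1"
  shows "cube_integral j (Y j) \<alpha> (f d) \<in> \<real> \<and>
         0 \<le> Re (cube_integral j (Y j) \<alpha> (f d)) \<and>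
         limsup (\<lambda>n. ereal (l2_norm X (ergodic_avg G d T F j f n)))
           \<le> ereal (Re (cube_integral j (Y j) \<alpha> (f d)) powr (1 / 2 ^ j))"
proof -
  interpret group G by fact
  interpret Folner_tower G d Y S \<kappa> \<xi> \<alpha> F
    by unfold_locales fact+
  note [simp] = \<open>Y 0 = X\<close> \<open>S 0 = T\<close>
  \<comment> \<open>Setting the value to 0 where the bound fails changes \<open>f i\<close> only on
    a null set and gives a bound along every orbit.\<close>
  define f' where "f' i x = (if cmod (f i x) \<le> 1 then f i x else 0)" for i x
  let ?I = "{d - j + 1..d}"
  have dI: "d \<in> ?I" using assms by auto
  have f'_unit: "f' i \<in> unit_meas (Y 0)" if "i \<in> ?I" for i
  proof -
    note [measurable] = assms(11)[OF that]
    show ?thesis by (auto simp: unit_meas_def f'_def[abs_def])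
  qed
  have ae: "AE x in Y 0. f i x = f' i x" if "i \<in> ?I" for i
    using assms(12)[OF that] unfolding \<open>Y 0 = X\<close> by eventually_elim (simp add: f'_def)
  have cube: "cube_integral j (Y j) \<alpha> (f d) = cube_integral j (Y j) \<alpha> (f' d)"
    using assms dI ae by (intro cube_integral_cong_AE unit_meas_measurable[OF f'_unit]) auto
  have fm: "f i \<in> borel_measurable (Y 0)" and f'm: "f' i \<in> borel_measurable (Y 0)" if "i \<in> ?I" for i
    using assms(11)[OF that] f'_unit[OF that] by (auto simp: unit_meas_measurable)
  have avg_measurable: "seg_avg j u n \<in> borel_measurable (Y 0)"
    if "\<And>i. i \<in> ?I \<Longrightarrow> u i \<in> borel_measurable (Y 0)" for u n
    unfolding seg_avg_def[abs_def]
  proof (intro mean_measurable borel_measurable_prod)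
    fix g i assume "g \<in> F n" "i \<in> ?I"
    then show "(\<lambda>x. u i (S 0 (seg G d (d - j + 1) i g) x)) \<in> borel_measurable (Y 0)"
      using that by (intro measurable_compose[OF X.act_measurable[OF seg_carrier[OF F_carrier]]])
  qed
  have l2: "l2_norm X (ergodic_avg G d T F j f n) = l2_norm (Y 0) (seg_avg j f' n)" for n
  proof -
    \<comment> \<open>Each average involves finitely many translates, whose exceptional sets are
      null by invariance.\<close>
    have "AE x in Y 0. \<forall>g\<in>F n. \<forall>i\<in>?I. f i (S 0 (seg G d (d - j + 1) i g) x) = f' i (S 0 (seg G d (d - j + 1) i g) x)"
    proof (subst AE_ball_countable[OF countable_finite[OF F_finite]], intro ballI,
        subst AE_ball_countable[OF countable_finite], simp, intro ballI)
      fix g i assume g: "g \<in> F n" and i: "i \<in> ?I"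
      note c = seg_carrier[OF F_carrier[OF g]]
      show "AE x in Y 0. f i (S 0 (seg G d (d - j + 1) i g) x) = f' i (S 0 (seg G d (d - j + 1) i g) x)"
        by (rule measure_preserving_prob_AE[OF X.act_measurable[OF c] X.act_distr[OF c] ae[OF i]])
    qed
    then have "AE x in Y 0. seg_avg j f n x = seg_avg j f' n x"
      by eventually_elim (auto simp: seg_avg_def intro!: mean_cong prod.cong)
    then have "(\<integral>x. (cmod (seg_avg j f n x))\<^sup>2 \<partial>Y 0) = (\<integral>x. (cmod (seg_avg j f' n x))\<^sup>2 \<partial>Y 0)"
      using avg_measurable[of f n] avg_measurable[of f' n] fm f'm by (intro integral_cong_AE) auto
    moreover have "(\<integral>x. (cmod (ergodic_avg G d (S 0) F j f n x))\<^sup>2 \<partial>Y 0) = (\<integral>x. (cmod (seg_avg j f n x))\<^sup>2 \<partial>Y 0)"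
      using assms by (intro Bochner_Integration.integral_cong refl) (simp add: ergodic_avg_eq[simplified])
    ultimately show ?thesis
      by (simp add: l2_norm_def)
  qed
  let ?c = "Re (cube_integral j (Y j) \<alpha> (f' d)) powr (1 / 2 ^ j)"
  \<comment> \<open>The eventual bound needs a strict inequality, hence the slack \<open>e\<close>,
    which is removed afterwards.\<close>
  have "limsup (\<lambda>n. ereal (l2_norm X (ergodic_avg G d T F j f n))) \<le> ereal ?c + ereal e" if "e > 0" for e
  proof -
    have "\<forall>\<^sub>F n in sequentially. l2_norm (Y 0) (seg_avg j f' n) \<le> ?c + e"
      using assms that f'_unit by (intro eventually_l2_norm_le) auto
    then show ?thesis
      unfolding l2 by (intro Limsup_bounded) (auto elim: eventually_mono)
  qed
  then have "limsup (\<lambda>n. ereal (l2_norm X (ergodic_avg G d T F j f n))) \<le> ereal ?c"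
    by (rule ereal_le_epsilon2)
  then show ?thesis
    unfolding cube using cube_nonneg[of j "f' d"] assms(6,7) f'_unit[OF dI] by simp
qed

end
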